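(* Let $K\ge 2$ be an integer and let $\alpha,\beta>0$ be constants with $\sqrt{\alpha}-\sqrt{\beta}>\sqrt{K}$. Let $\bm{A}$ be the adjacency matrix of a realization of the random graph generated according to the symmetric SBM with parameters $(n,K,p,q)$ and a planted partition $\bm{H}^*\in\mathbb{H}_{n,K}$, where $p=\alpha\log n/n$, $q=\beta\log n/n$, and $n$ is sufficiently large. Then there exists a constant $\gamma>0$, whose value depends only on $\alpha,\beta,K$, such that if the projected power method uses an initial point $\bm{H}^0\in\mathbb{M}_{n,K}$ satisfying $$\min_{\bm{Q}\in\Pi_K}\|\bm{H}^0-\bm{H}^*\bm{Q}\|_F\le\theta\sqrt{n},\qquad \theta=\frac14\min\left\{\frac{1}{\sqrt{K}},\frac{\gamma\sqrt{K}}{16(\alpha-\beta)}\right\},$$ then it outputs a true partition (i.e., $\bm{H}^*\bm{Q}$ for some $\bm{Q}\in\Pi_K$) in $$\mathcal{O}\left(\left(K^2+3\alpha+3(K-1)\beta\right)\frac{n\log^2 n}{\log\log n}\right)$$ time with probability at least $1-n^{-\Omega(1)}$.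
   Context: Throughout, $n=mK$ with $m$ a positive integer, $\|\cdot\|_F$ is the Frobenius norm, $[n]=\{1,\dots,n\}$, $\bm{1}_d$ is the all-one vector in $\mathbb{R}^d$, and $\Pi_K$ is the set of all $K\times K$ permutation matrices. Clustering matrices: $\bm{H}\in\mathbb{R}^{n\times K}$ is a clustering matrix if there are pairwise disjoint sets $\mathcal{I}_1,\dots,\mathcal{I}_K$ with $\bigcup_k\mathcal{I}_k=[n]$ such that $h_{ik}=1$ if $i\in\mathcal{I}_k$ and $h_{ik}=0$ otherwise; it is balanced if in addition $|\mathcal{I}_k|=m$ for all $k$. $\mathbb{M}_{n,K}$ and $\mathbb{H}_{n,K}$ denote the sets of all clustering matrices and of all balanced clustering matrices, respectively. Symmetric SBM with parameters $(n,K,p,q)$ and planted partition $\bm{H}^*\in\mathbb{H}_{n,K}$: a random graph on $[n]$ whose symmetric adjacency matrix $\bm{A}=(a_{ij})$ has independent entries $\{a_{ij}\}_{1\le i\le j\le n}$ (diagonal included), with $a_{ij}\sim\mathrm{Bernoulli}(p)$ if rows $i$ and $j$ of $\bm{H}^*$ are equal (same community) and $a_{ij}\sim\mathrm{Bernoulli}(q)$ otherwise. Projection: $\mathcal{H}=\{\bm{H}\in\{0,1\}^{n\times K}:\bm{H}\bm{1}_K=\bm{1}_n,\ \bm{H}^T\bm{1}_n=m\bm{1}_K\}$, and for $\bm{C}\in\mathbb{R}^{n\times K}$, $\mathcal{T}(\bm{C})=\operatorname{argmin}\{\|\bm{H}-\bm{C}\|_F:\bm{H}\in\mathcal{H}\}$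 (the set of all minimizers). Projected power method with input $\bm{A}$, a positive integer $N$ and an initial point $\bm{H}^0$: choose any $\bm{H}^1\in\mathcal{T}(\bm{H}^0)$; for $k=1,\dots,N$ choose any $\bm{H}^{k+1}\in\mathcal{T}(\bm{A}\bm{H}^k)$; output $\bm{H}^{N+1}$. Here the number of iterations is $N=\lceil 2\log\log n\rceil+\lceil 2\log n/\log\log n\rceil+2$. Time is the number of elementary (real-arithmetic and comparison) operations; the cost of producing $\bm{H}^0$ is not counted. Each matrix product $\bm{A}\bm{H}^k$ is computed using the nonzero entries of $\bm{A}$ only, and each projection $\mathcal{T}(\cdot)$ is computed as a minimum-cost assignment problem in $\mathcal{O}(K^2n\log n)$ time. "With probability at least $1-n^{-\Omega(1)}$" means: with probability at least $1-n^{-c}$ for a constant $c>0$ depending only on $\alpha,\beta,K$, for all $n$ larger than a constant depending only on $\alpha,\beta,K$. *)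

theory Defs
  imports
    "HOL-Probability.Product_PMF"
    "HOL-Combinatorics.Permutations"
    "Jordan_Normal_Form.Matrix"
begin

text \<open>The vertex set is \<open>{..<n}\<close> and the communities are indexed by \<open>{..<K}\<close>.\<close>

definition frob_norm :: "real mat \<Rightarrow> real" where
  "frob_norm A = sqrt (\<Sum>i<dim_row A. \<Sum>j<dim_col A. (A $$ (i, j))\<^sup>2)"

definition ones_vec :: "nat \<Rightarrow> real Matrix.vec" where
  "ones_vec d = Matrix.vec d (\<lambda>_. 1)"

definition perm_mats :: "nat \<Rightarrow> real mat set" where
  "perm_mats K = {Matrix.mat K K (\<lambda>(i, j). of_bool (\<sigma> i = j)) | \<sigma>. \<sigma> permutes {..<K}}"

lemma finite_perm_mats: "finite (perm_mats K)"
  unfolding perm_mats_def using finite_permutations[of "{..<K}"] by (simp add: setcompr_eq_image)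

lemma perm_mats_nonempty: "perm_mats K \<noteq> {}"
  using permutes_id[of "{..<K}"] unfolding perm_mats_def by blast


subsection \<open>Clustering matrices\<close>

definition clustering_by :: "nat \<Rightarrow> nat \<Rightarrow> (nat \<Rightarrow> nat set) \<Rightarrow> real mat \<Rightarrow> bool" where
  "clustering_by n K I H \<longleftrightarrow>
     H \<in> carrier_mat n K \<and> disjoint_family_on I {..<K} \<and> (\<Union>k<K. I k) = {..<n} \<and>
     (\<forall>i<n. \<forall>k<K. H $$ (i, k) = (if i \<in> I k then 1 else 0))"

definition clustering_mats :: "nat \<Rightarrow> nat \<Rightarrow> real mat set" where
  "clustering_mats n K = {H. \<exists>I. clustering_by n K I H}"

definition balanced_clustering_mats :: "nat \<Rightarrow> nat \<Rightarrow> real mat set" where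
  "balanced_clustering_mats m K =
     {H. \<exists>I. clustering_by (m * K) K I H \<and> (\<forall>k<K. card (I k) = m)}"


subsection \<open>The symmetric stochastic block model\<close>

text \<open>One independent Bernoulli variable for every pair \<open>i \<le> j\<close>, loops included; the matrix is
  their symmetric extension.\<close>

definition sbm_pmf :: "nat \<Rightarrow> real \<Rightarrow> real \<Rightarrow> real mat \<Rightarrow> real mat pmf" where
  "sbm_pmf n p q Hs =
     map_pmf (\<lambda>e. Matrix.mat n n (\<lambda>(i, j). of_bool (e (min i j, max i j))))
       (Pi_pmf {(i, j). i \<le> j \<and> j < n} False
          (\<lambda>(i, j). bernoulli_pmf (if Matrix.row Hs i = Matrix.row Hs j then p else q)))"


subsection \<open>Projection\<close>

definition feasible_mats :: "nat \<Rightarrow> nat \<Rightarrow> real mat set" where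
  "feasible_mats m K =
     {H \<in> carrier_mat (m * K) K.
        (\<forall>i<m * K. \<forall>k<K. H $$ (i, k) \<in> {0, 1}) \<and>
        H *\<^sub>v ones_vec K = ones_vec (m * K) \<and>
        transpose_mat H *\<^sub>v ones_vec (m * K) = real m \<cdot>\<^sub>v ones_vec K}"

definition proj :: "nat \<Rightarrow> nat \<Rightarrow> real mat \<Rightarrow> real mat set" where
  "proj m K C = {H. is_arg_min (\<lambda>H. frob_norm (H - C)) (\<lambda>H. H \<in> feasible_mats m K) H}"

lemma finite_feasible_mats: "finite (feasible_mats m K)"
proof -
  let ?P = "PiE ({..<m * K} \<times> {..<K}) (\<lambda>_. {0, 1 :: real})"
  have "feasible_mats m K \<subseteq> Matrix.mat (m * K) K ` ?P"
  proof
    fix H assume H: "H \<in> feasible_mats m K"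
    let ?f = "restrict (\<lambda>ij. H $$ ij) ({..<m * K} \<times> {..<K})"
    have "H = Matrix.mat (m * K) K ?f"
      using H by (intro eq_matI) (auto simp: feasible_mats_def)
    moreover have "?f \<in> ?P"
      using H by (auto simp: feasible_mats_def)
    ultimately show "H \<in> Matrix.mat (m * K) K ` ?P" by blast
  qed
  moreover have "finite ?P" by (intro finite_PiE) auto
  ultimately show ?thesis by (blast intro: finite_subset)
qed

lemma feasible_mats_nonempty:
  assumes "m > 0"
  shows "feasible_mats m K \<noteq> {}"
proof -
  let ?H = "Matrix.mat (m * K) K (\<lambda>(i, k). of_bool (i div m = k)) :: real mat"
  have less: "i div m < K" if "i < m * K" for i
    using that assms by (simp add: less_mult_imp_div_less mult.commute)
  have "?H *\<^sub>v ones_vec K = ones_vec (m * K)"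
  proof (intro eq_vecI)
    fix i assume "i < dim_vec (ones_vec (m * K))"
    then have i: "i < m * K" by (simp add: ones_vec_def)
    have "(?H *\<^sub>v ones_vec K) $ i = (\<Sum>k<K. of_bool (i div m = k))"
      using i by (simp add: ones_vec_def scalar_prod_def lessThan_atLeast0)
    also have "\<dots> = 1"
      using less[OF i] by (subst sum.remove[of _ "i div m"]) auto
    finally show "(?H *\<^sub>v ones_vec K) $ i = ones_vec (m * K) $ i"
      using i by (simp add: ones_vec_def)
  qed (simp add: ones_vec_def)
  moreover have "transpose_mat ?H *\<^sub>v ones_vec (m * K) = real m \<cdot>\<^sub>v ones_vec K"
  proof (intro eq_vecI)
    fix k assume "k < dim_vec (real m \<cdot>\<^sub>v ones_vec K)"
    then have k: "k < K" by (simp add: ones_vec_def)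
    have "(transpose_mat ?H *\<^sub>v ones_vec (m * K)) $ k = (\<Sum>i<m * K. of_bool (i div m = k))"
      using k by (simp add: ones_vec_def scalar_prod_def lessThan_atLeast0)
    also have "\<dots> = real (card {i \<in> {..<m * K}. i div m = k})"
      by (simp add: of_bool_def sum.If_cases Int_def)
    also have "{i \<in> {..<m * K}. i div m = k} = {k * m..<k * m + m}"
    proof (rule equalityI; rule subsetI)
      fix i assume "i \<in> {i \<in> {..<m * K}. i div m = k}"
      then show "i \<in> {k * m..<k * m + m}"
        using dividend_less_div_times[OF assms, of i] by (auto simp: add.commute)
    next
      fix i assume i: "i \<in> {k * m..<k * m + m}"
      have "i div m = k"
        using i by (intro div_nat_eqI) (auto simp: algebra_simps)
      moreover have "k * m + m \<le> m * K"
        using mult_le_mono2[of "Suc k" K m] k by (simp add: algebra_simps)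
      ultimately show "i \<in> {i \<in> {..<m * K}. i div m = k}"
        using i by auto
    qed
    finally show "(transpose_mat ?H *\<^sub>v ones_vec (m * K)) $ k = (real m \<cdot>\<^sub>v ones_vec K) $ k"
      using k by (simp add: ones_vec_def)
  qed (simp add: ones_vec_def)
  ultimately have "?H \<in> feasible_mats m K"
    by (auto simp: feasible_mats_def)
  then show ?thesis by blast
qed

lemma proj_nonempty:
  assumes "m > 0"
  shows "proj m K C \<noteq> {}"
proof -
  obtain H where "H \<in> feasible_mats m K"
    "\<And>H'. H' \<in> feasible_mats m K \<Longrightarrow> frob_norm (H - C) \<le> frob_norm (H' - C)"
    using ex_min_if_finite[of "(\<lambda>H. frob_norm (H - C)) ` feasible_mats m K"]
      finite_feasible_mats[of m K] feasible_mats_nonempty[OF assms, of K]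
    by (auto simp: not_less)
  then show ?thesis by (auto simp: proj_def is_arg_min_linorder)
qed


subsection \<open>Matrix product over the nonzero entries, with operation count\<close>

text \<open>The sparse matrix \<open>A\<close> is given together with the list of positions of its nonzero entries.
  Every term \<open>A\<^sub>i\<^sub>j H\<^sub>j\<^sub>k\<close> with \<open>A\<^sub>i\<^sub>j \<noteq> 0\<close> costs two operations, a multiplication and an
  addition; the second component counts them.\<close>

definition nonzeros :: "real mat \<Rightarrow> (nat \<times> nat) list" where
  "nonzeros A = [(i, j). i \<leftarrow> [0..<dim_row A], j \<leftarrow> [0..<dim_col A], A $$ (i, j) \<noteq> 0]"

fun spmm_loop ::
  "real mat \<Rightarrow> real mat \<Rightarrow> (nat \<times> nat \<times> nat) list \<Rightarrow> real mat \<times> nat \<Rightarrow> real mat \<times> nat" where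
  "spmm_loop A H [] (R, t) = (R, t)"
| "spmm_loop A H ((i, j, k) # xs) (R, t) =
     spmm_loop A H xs (R |\<^sub>m (i, k) \<mapsto> (R $$ (i, k) + A $$ (i, j) * H $$ (j, k)), t + 2)"

definition spmm :: "real mat \<Rightarrow> real mat \<Rightarrow> real mat \<times> nat" where
  "spmm A H = spmm_loop A H [(i, j, k). (i, j) \<leftarrow> nonzeros A, k \<leftarrow> [0..<dim_col H]]
     (0\<^sub>m (dim_row A) (dim_col H), 0)"

lemma snd_spmm_loop: "snd (spmm_loop A H xs (R, t)) = t + 2 * length xs"
  by (induction A H xs "(R, t)" arbitrary: R t rule: spmm_loop.induct) auto

lemma dim_spmm_loop:
  "dim_row (fst (spmm_loop A H xs (R, t))) = dim_row R"
  "dim_col (fst (spmm_loop A H xs (R, t))) = dim_col R"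
  by (induction A H xs "(R, t)" arbitrary: R t rule: spmm_loop.induct)
     (auto simp: update_mat_def)

lemma fst_spmm_loop:
  assumes "a < dim_row R" "b < dim_col R"
  shows "fst (spmm_loop A H xs (R, t)) $$ (a, b) = R $$ (a, b) +
    (\<Sum>(i, j, k)\<leftarrow>xs. if i = a \<and> k = b then A $$ (i, j) * H $$ (j, k) else 0)"
  using assms
  by (induction A H xs "(R, t)" arbitrary: R t rule: spmm_loop.induct)
     (auto simp: update_mat_def)

lemma set_nonzeros:
  "set (nonzeros A) = {(i, j). i < dim_row A \<and> j < dim_col A \<and> A $$ (i, j) \<noteq> 0}"
  by (auto simp: nonzeros_def)

lemma distinct_nonzeros: "distinct (nonzeros A)"
proof -
  have "nonzeros A =
      filter (\<lambda>ij. A $$ ij \<noteq> 0) (List.product [0..<dim_row A] [0..<dim_col A])"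
  proof -
    have *: "concat (map (\<lambda>j. if P j then [(i, j)] else []) ys) = map (Pair i) (filter P ys)"
      for i :: nat and P and ys :: "nat list"
      by (induction ys) auto
    have **: "concat (map (\<lambda>i. map (Pair i) (filter (\<lambda>j. A $$ (i, j) \<noteq> 0) ys)) xs) =
        filter (\<lambda>ij. A $$ ij \<noteq> 0) (List.product xs ys)" for xs ys
      by (induction xs) (auto simp: filter_map o_def)
    show ?thesis by (simp add: nonzeros_def * **)
  qed
  then show ?thesis by (simp add: distinct_product)
qed

lemma snd_spmm:
  "snd (spmm A H) =
     2 * dim_col H * card {(i, j). i < dim_row A \<and> j < dim_col A \<and> A $$ (i, j) \<noteq> 0}"
proof -
  have "length [(i, j, k). (i, j) \<leftarrow> xs, k \<leftarrow> [0..<d]] = length xs * d"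
    for xs :: "(nat \<times> nat) list" and d
    by (induction xs) auto
  then show ?thesis
    using distinct_card[OF distinct_nonzeros[of A]]
    by (simp add: spmm_def snd_spmm_loop set_nonzeros)
qed

lemma fst_spmm:
  assumes "dim_col A = dim_row H"
  shows "fst (spmm A H) = A * H"
proof (intro eq_matI)
  fix a b assume "a < dim_row (A * H)" "b < dim_col (A * H)"
  then have ab: "a < dim_row A" "b < dim_col H" by auto
  define g where "g = (\<lambda>(i, j, k). if i = a \<and> k = b then A $$ (i, j) * H $$ (j, k) else 0)"
  have inner: "(\<Sum>x\<leftarrow>map (\<lambda>k. (i, j, k)) [0..<dim_col H]. g x) =
      (if i = a then A $$ (a, j) * H $$ (j, b) else 0)" for i j
  proof -
    have "(\<Sum>x\<leftarrow>map (\<lambda>k. (i, j, k)) [0..<dim_col H]. g x) = (\<Sum>k<dim_col H. g (i, j, k))"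
      by (simp add: o_def interv_sum_list_conv_sum_set_nat lessThan_atLeast0)
    also have "\<dots> = (\<Sum>k<dim_col H. if k = b then (if i = a then A $$ (a, j) * H $$ (j, b) else 0) else 0)"
      by (intro sum.cong) (auto simp: g_def)
    finally show ?thesis using ab by simp
  qed
  have "(\<Sum>x\<leftarrow>[(i, j, k). (i, j) \<leftarrow> xs, k \<leftarrow> [0..<dim_col H]]. g x) =
      (\<Sum>(i, j)\<leftarrow>xs. if i = a then A $$ (a, j) * H $$ (j, b) else 0)" for xs
  proof (induction xs)
    case (Cons x xs)
    then show ?case using inner[of "fst x" "snd x"] by (cases x) simp
  qed simp
  then have "(\<Sum>x\<leftarrow>[(i, j, k). (i, j) \<leftarrow> nonzeros A, k \<leftarrow> [0..<dim_col H]]. g x) =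
      (\<Sum>(i, j)\<in>set (nonzeros A). if i = a then A $$ (a, j) * H $$ (j, b) else 0)"
    by (simp add: sum_list_distinct_conv_sum_set[OF distinct_nonzeros])
  also have "\<dots> = (\<Sum>(i, j)\<in>{..<dim_row A} \<times> {..<dim_col A}.
      if i = a then A $$ (a, j) * H $$ (j, b) else 0)"
    by (intro sum.mono_neutral_left) (auto simp: set_nonzeros split: if_splits)
  also have "\<dots> = (\<Sum>i<dim_row A. \<Sum>j<dim_col A.
      if i = a then A $$ (a, j) * H $$ (j, b) else 0)"
    by (simp add: sum.cartesian_product)
  also have "\<dots> = (\<Sum>i<dim_row A. if i = a then \<Sum>j<dim_col A. A $$ (a, j) * H $$ (j, b) else 0)"
    by (intro sum.cong) auto
  also have "\<dots> = (A * H) $$ (a, b)"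
    using ab assms by (simp add: scalar_prod_def lessThan_atLeast0)
  finally show "fst (spmm A H) $$ (a, b) = (A * H) $$ (a, b)"
    using ab by (simp add: spmm_def fst_spmm_loop g_def)
qed (auto simp: spmm_def dim_spmm_loop)


subsection \<open>Projected power method\<close>

text \<open>A call of the minimum-cost assignment solver may return any minimizer and may use any number
  of operations up to \<open>cP K\<^sup>2 n log n\<close>, where \<open>cP\<close> is the constant of the solver.\<close>

definition timed_proj :: "real \<Rightarrow> nat \<Rightarrow> nat \<Rightarrow> real mat \<Rightarrow> (real mat \<times> nat) set" where
  "timed_proj cP m K C =
     {(H, t). H \<in> proj m K C \<and>
        real t \<le> cP * (real K)\<^sup>2 * real (m * K) * ln (real (m * K))}"

text \<open>\<open>ppm cP m K A H0 k\<close> is the set of all pairs of an iterate \<open>H\<^sup>k\<^sup>+\<^sup>1\<close> and the number of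
  operations spent so far, over all choices of minimizers and all admissible solver times.\<close>

primrec ppm ::
  "real \<Rightarrow> nat \<Rightarrow> nat \<Rightarrow> real mat \<Rightarrow> real mat \<Rightarrow> nat \<Rightarrow> (real mat \<times> nat) set" where
  "ppm cP m K A H0 0 = timed_proj cP m K H0"
| "ppm cP m K A H0 (Suc k) =
     {(H', t + s + t') | H t B s H' t'.
        (H, t) \<in> ppm cP m K A H0 k \<and> (B, s) = spmm A H \<and> (H', t') \<in> timed_proj cP m K B}"

lemma timed_proj_nonempty:
  assumes "m > 0" "cP \<ge> 0"
  shows "timed_proj cP m K C \<noteq> {}"
proof -
  obtain H where H: "H \<in> proj m K C" using proj_nonempty[OF assms(1)] by blast
  have "ln (real (m * K)) \<ge> 0"
    by (cases "m * K") (simp_all only: of_nat_0 ln_0 order.refl, intro ln_ge_zero, simp)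
  then have "(H, 0) \<in> timed_proj cP m K C"
    using H assms(2) by (simp add: timed_proj_def)
  then show ?thesis by blast
qed

lemma ppm_nonempty:
  assumes "m > 0" "cP \<ge> 0"
  shows "ppm cP m K A H0 k \<noteq> {}"
proof (induction k)
  case 0
  then show ?case using timed_proj_nonempty[OF assms] by simp
next
  case (Suc k)
  then obtain H t where H: "(H, t) \<in> ppm cP m K A H0 k" by auto
  obtain B s where B: "(B, s) = spmm A H" by (metis surj_pair)
  obtain H' t' where "(H', t') \<in> timed_proj cP m K B"
    using timed_proj_nonempty[OF assms] by fast
  with H B have "(H', t + s + t') \<in> ppm cP m K A H0 (Suc k)"
    unfolding ppm.simps by blast
  then show ?case by blast
qed

definition ppm_rounds :: "nat \<Rightarrow> nat" where
  "ppm_rounds n = nat \<lceil>2 * ln (ln (real n))\<rceil> + nat \<lceil>2 * ln (real n) / ln (ln (real n))\<rceil> + 2"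

end

theory Submission
  imports Defs "HOL-Real_Asymp.Real_Asymp"
begin

text \<open>Let \<open>S\<close> and \<open>T\<close> be the sets of vertices misclassified by two consecutive iterates, with respect
  to the permuted truth nearest to \<open>H0\<close>. The new iterate maximises the inner product with \<open>A H\<close>, so the
  loss of the vertices in \<open>T\<close>, measured in degrees towards the true communities, is compensated by the edges
  between \<open>T\<close> and \<open>S\<close>. With high probability two things hold. Every vertex has at least \<open>\<gamma> ln n\<close> more
  neighbours in its own community than in any other one (this needs \<open>sqrt \<alpha> - sqrt \<beta> > sqrt K\<close>). Moreover
  there are fewer than \<open>(\<gamma> / 2) ln n |T|\<close> edges between any \<open>T\<close> and any set \<open>S\<close> of at most \<open>\<epsilon> n\<close> vertices
  with \<open>|S| \<le> const |T| ln n\<close>, by a union bound. Hence \<open>|T| \<le> const |S| / ln n\<close>: each round divides the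
  number of errors by a multiple of \<open>ln n\<close>, and \<open>2 ln n / ln ln n\<close> rounds leave none. No spectral bound on
  \<open>A\<close> minus its mean is needed.\<close>

subsection \<open>Label matrices and one step of the projected power method\<close>

text \<open>Initial points, iterates and permuted truths are all encoded by labellings, so that
  errors become sets of vertices. Only the labels of vertices \<open>i < n\<close> matter.\<close>

definition label_mat :: "nat \<Rightarrow> nat \<Rightarrow> (nat \<Rightarrow> nat) \<Rightarrow> real mat" where
  "label_mat n K h = Matrix.mat n K (\<lambda>(i, k). of_bool (h i = k))"

definition misfits :: "nat \<Rightarrow> (nat \<Rightarrow> nat) \<Rightarrow> (nat \<Rightarrow> nat) \<Rightarrow> nat set" where
  "misfits n h g = {i. i < n \<and> h i \<noteq> g i}"

lemma finite_misfits [simp]: "finite (misfits n h g)"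
  by (simp add: misfits_def)

lemma card_misfits_triangle:
  "card (misfits n h g) \<le> card (misfits n h f) + card (misfits n f g)"
proof -
  have "misfits n h g \<subseteq> misfits n h f \<union> misfits n f g" by (auto simp: misfits_def)
  then have "card (misfits n h g) \<le> card (misfits n h f \<union> misfits n f g)"
    by (intro card_mono) auto
  also have "\<dots> \<le> card (misfits n h f) + card (misfits n f g)" by (rule card_Un_le)
  finally show ?thesis .
qed

lemma label_mat_simps [simp]:
  "dim_row (label_mat n K h) = n" "dim_col (label_mat n K h) = K"
  "i < n \<Longrightarrow> k < K \<Longrightarrow> label_mat n K h $$ (i, k) = of_bool (h i = k)"
  by (simp_all add: label_mat_def)

lemma label_mat_cong: "(\<And>i. i < n \<Longrightarrow> h i = g i) \<Longrightarrow> label_mat n K h = label_mat n K g"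
  by (intro eq_matI) auto

lemma clustering_by_label_mat:
  assumes "clustering_by n K I H"
  obtains h where "\<And>i. i < n \<Longrightarrow> h i < K" "H = label_mat n K h"
    "\<And>k. k < K \<Longrightarrow> I k = {i. i < n \<and> h i = k}"
proof -
  note A = assms[unfolded clustering_by_def]
  have "\<exists>k<K. i \<in> I k" if "i < n" for i using A that by blast
  then obtain h where h: "\<And>i. i < n \<Longrightarrow> h i < K \<and> i \<in> I (h i)" by metis
  have iff: "i \<in> I k \<longleftrightarrow> h i = k" if "i < n" "k < K" for i k
    using h[OF that(1)] A that unfolding disjoint_family_on_def by blast
  have "H = label_mat n K h"
    using A iff by (intro eq_matI) auto
  moreover have "I k = {i. i < n \<and> h i = k}" if "k < K" for k
  proof -
    have "I k \<subseteq> {..<n}" using A that by blast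
    then show ?thesis using iff that by auto
  qed
  ultimately show ?thesis using that h by blast
qed

lemma label_mat_mult_ones:
  assumes "\<And>i. i < n \<Longrightarrow> h i < K"
  shows "label_mat n K h *\<^sub>v ones_vec K = ones_vec n"
proof (intro eq_vecI)
  fix i assume "i < dim_vec (ones_vec n)"
  then have i: "i < n" by (simp add: ones_vec_def)
  have "(label_mat n K h *\<^sub>v ones_vec K) $ i = (\<Sum>k<K. of_bool (h i = k))"
    using i by (simp add: ones_vec_def scalar_prod_def lessThan_atLeast0)
  also have "\<dots> = 1"
    using assms[OF i] by (subst sum.remove[of _ "h i"]) auto
  finally show "(label_mat n K h *\<^sub>v ones_vec K) $ i = ones_vec n $ i"
    using i by (simp add: ones_vec_def)
qed (simp add: ones_vec_def)

lemma label_mat_feasible: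
  assumes "\<And>i. i < m * K \<Longrightarrow> h i < K"
    and "\<And>k. k < K \<Longrightarrow> card {i. i < m * K \<and> h i = k} = m"
  shows "label_mat (m * K) K h \<in> feasible_mats m K"
proof -
  have "transpose_mat (label_mat (m * K) K h) *\<^sub>v ones_vec (m * K) = real m \<cdot>\<^sub>v ones_vec K"
  proof (intro eq_vecI)
    fix k assume "k < dim_vec (real m \<cdot>\<^sub>v ones_vec K)"
    then have k: "k < K" by (simp add: ones_vec_def)
    have "(transpose_mat (label_mat (m * K) K h) *\<^sub>v ones_vec (m * K)) $ k
        = (\<Sum>i<m * K. of_bool (h i = k))"
      using k by (simp add: ones_vec_def scalar_prod_def lessThan_atLeast0)
    also have "\<dots> = real (card {i. i < m * K \<and> h i = k})"
      by (simp add: of_bool_def sum.If_cases Int_def)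
    finally show "(transpose_mat (label_mat (m * K) K h) *\<^sub>v ones_vec (m * K)) $ k
        = (real m \<cdot>\<^sub>v ones_vec K) $ k"
      using k assms(2) by (simp add: ones_vec_def)
  qed (simp add: ones_vec_def)
  moreover have "label_mat (m * K) K h \<in> carrier_mat (m * K) K" by (rule carrier_matI) simp_all
  ultimately show ?thesis
    using label_mat_mult_ones[of "m * K" h K, OF assms(1)] by (auto simp: feasible_mats_def)
qed

text \<open>A 0/1 row with sum one contains exactly one 1; its column is the label.\<close>

lemma feasible_label_mat:
  assumes "H \<in> feasible_mats m K"
  obtains h where "\<And>i. i < m * K \<Longrightarrow> h i < K" "H = label_mat (m * K) K h"
proof -
  from assms have H: "H \<in> carrier_mat (m * K) K"
    "\<And>i k. i < m * K \<Longrightarrow> k < K \<Longrightarrow> H $$ (i, k) = 0 \<or> H $$ (i, k) = 1"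
    "H *\<^sub>v ones_vec K = ones_vec (m * K)"
    by (auto simp: feasible_mats_def)
  have "\<exists>l<K. \<forall>k<K. H $$ (i, k) = of_bool (l = k)" if i: "i < m * K" for i
  proof -
    have "1 = (H *\<^sub>v ones_vec K) $ i" using H i by (simp add: ones_vec_def)
    also have "\<dots> = (\<Sum>k<K. H $$ (i, k))"
      using i H(1) by (auto simp: ones_vec_def scalar_prod_def lessThan_atLeast0 intro!: sum.cong)
    also have "\<dots> = (\<Sum>k<K. if H $$ (i, k) = 1 then 1 else 0)"
      using H(2)[OF i] by (intro sum.cong) auto
    also have "\<dots> = real (card {k. k < K \<and> H $$ (i, k) = 1})"
      by (simp add: sum.If_cases Int_def)
    finally have "card {k. k < K \<and> H $$ (i, k) = 1} = 1" by simp
    then obtain l where l: "{k. k < K \<and> H $$ (i, k) = 1} = {l}" by (auto simp: card_1_singleton_iff)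
    then have "l < K" "H $$ (i, l) = 1" by auto
    moreover have "H $$ (i, k) = 0" if "k < K" "k \<noteq> l" for k
      using H(2)[OF i that(1)] l that by auto
    ultimately show ?thesis by (intro exI[of _ l]) (auto simp: of_bool_def)
  qed
  then obtain h where h: "\<And>i. i < m * K \<Longrightarrow> h i < K \<and> (\<forall>k<K. H $$ (i, k) = of_bool (h i = k))"
    by metis
  then have "H = label_mat (m * K) K h" using H(1) by (intro eq_matI) auto
  then show ?thesis using that h by blast
qed

text \<open>Permuting columns is relabelling, so every true partition is again a label
  matrix.\<close>

lemma label_mat_mult_perm_mat:
  assumes "\<And>i. i < n \<Longrightarrow> g i < K"
  shows "label_mat n K g * Matrix.mat K K (\<lambda>(i, j). of_bool (\<sigma> i = j)) = label_mat n K (\<sigma> \<circ> g)"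
proof (intro eq_matI)
  fix i k assume "i < dim_row (label_mat n K (\<sigma> \<circ> g))" "k < dim_col (label_mat n K (\<sigma> \<circ> g))"
  then have ik: "i < n" "k < K" by auto
  have "(label_mat n K g * Matrix.mat K K (\<lambda>(i, j). of_bool (\<sigma> i = j))) $$ (i, k)
      = (\<Sum>l<K. of_bool (g i = l) * of_bool (\<sigma> l = k))"
    using ik by (simp add: scalar_prod_def lessThan_atLeast0)
  also have "\<dots> = of_bool (\<sigma> (g i) = k)"
    using assms[OF ik(1)] by (subst sum.remove[of _ "g i"]) auto
  finally show "(label_mat n K g * Matrix.mat K K (\<lambda>(i, j). of_bool (\<sigma> i = j))) $$ (i, k)
      = label_mat n K (\<sigma> \<circ> g) $$ (i, k)"
    using ik by simp
qed auto

section \<open>Frobenius distance and projection of label matrices\<close>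

lemma frob_norm_square:
  "(frob_norm A)\<^sup>2 = (\<Sum>i<dim_row A. \<Sum>j<dim_col A. (A $$ (i, j))\<^sup>2)"
  unfolding frob_norm_def by (simp add: sum_nonneg)

lemma frob_norm_nonneg: "frob_norm A \<ge> 0"
  unfolding frob_norm_def by (simp add: sum_nonneg)

text \<open>Distinct unit rows lie at squared distance 2. This converts the radius around the truth
  into a number of misclassified vertices.\<close>

lemma frob_norm_label_mat_diff:
  assumes "\<And>i. i < n \<Longrightarrow> h i < K" "\<And>i. i < n \<Longrightarrow> g i < K"
  shows "(frob_norm (label_mat n K h - label_mat n K g))\<^sup>2 = 2 * real (card (misfits n h g))"
proof -
  have "(\<Sum>k<K. (of_bool (h i = k) - of_bool (g i = k))\<^sup>2) = (if h i \<noteq> g i then 2 else 0 :: real)"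
    if "i < n" for i
  proof (cases "h i = g i")
    case False
    have "(\<Sum>k<K. (of_bool (h i = k) - of_bool (g i = k))\<^sup>2)
        = (\<Sum>k<K. of_bool (h i = k) + of_bool (g i = k) :: real)"
      using False by (intro sum.cong) auto
    also have "\<dots> = 2"
      using assms[OF that] by (simp add: sum.distrib of_bool_def)
    finally show ?thesis using False by simp
  qed simp
  then have "(\<Sum>i<n. \<Sum>k<K. (of_bool (h i = k) - of_bool (g i = k))\<^sup>2)
      = (\<Sum>i<n. if h i \<noteq> g i then 2 else 0 :: real)"
    by (intro sum.cong) auto
  also have "\<dots> = 2 * real (card (misfits n h g))"
    by (simp add: sum.If_cases misfits_def Int_def)
  finally show ?thesis by (simp add: frob_norm_square)
qed

text \<open>Since \<open>g\<close> is feasible, the projection is at least as close to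
  \<open>h0\<close> as \<open>g\<close> is; the triangle inequality then costs the factor 2. The
  labelling \<open>h0\<close> itself may be unbalanced.\<close>

lemma proj_label_mat:
  assumes H: "H \<in> proj m K (label_mat (m * K) K h0)" and h0: "\<And>i. i < m * K \<Longrightarrow> h0 i < K"
    and g: "\<And>i. i < m * K \<Longrightarrow> g i < K" "label_mat (m * K) K g \<in> feasible_mats m K"
  obtains h where "\<And>i. i < m * K \<Longrightarrow> h i < K" "H = label_mat (m * K) K h"
    "card (misfits (m * K) h g) \<le> 2 * card (misfits (m * K) h0 g)"
proof -
  let ?n = "m * K"
  have min: "H \<in> feasible_mats m K"
    "frob_norm (H - label_mat ?n K h0) \<le> frob_norm (label_mat ?n K g - label_mat ?n K h0)"
    using H g(2) by (auto simp: proj_def is_arg_min_linorder)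
  obtain h where h: "\<And>i. i < ?n \<Longrightarrow> h i < K" "H = label_mat ?n K h"
    using feasible_label_mat[OF min(1)] by blast
  have "2 * real (card (misfits ?n h h0)) \<le> 2 * real (card (misfits ?n g h0))"
    using power_mono[OF min(2) frob_norm_nonneg, of 2]
    by (simp only: h(2) frob_norm_label_mat_diff h(1) g(1) h0)
  then have "card (misfits ?n h h0) \<le> card (misfits ?n g h0)" by simp
  moreover have "misfits ?n g h0 = misfits ?n h0 g" by (auto simp: misfits_def)
  ultimately have "card (misfits ?n h g) \<le> 2 * card (misfits ?n h0 g)"
    using card_misfits_triangle[of ?n h g h0] by simp
  then show ?thesis using that h by blast
qed

text \<open>All feasible matrices have the same norm, so projecting \<open>C\<close> maximises the inner product
  with \<open>C\<close>.\<close>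

lemma proj_inner_mono:
  assumes C: "C \<in> carrier_mat (m * K) K"
    and h: "\<And>i. i < m * K \<Longrightarrow> h i < K" "label_mat (m * K) K h \<in> proj m K C"
    and g: "\<And>i. i < m * K \<Longrightarrow> g i < K" "label_mat (m * K) K g \<in> feasible_mats m K"
  shows "(\<Sum>i<m * K. C $$ (i, g i)) \<le> (\<Sum>i<m * K. C $$ (i, h i))"
proof -
  let ?n = "m * K"
  define c where "c = (\<Sum>i<?n. \<Sum>k<K. (C $$ (i, k))\<^sup>2)"
  have *: "(frob_norm (label_mat ?n K f - C))\<^sup>2 = real ?n - 2 * (\<Sum>i<?n. C $$ (i, f i)) + c"
    if f: "\<And>i. i < ?n \<Longrightarrow> f i < K" for f
  proof -
    have "(\<Sum>k<K. (of_bool (f i = k) - C $$ (i, k))\<^sup>2)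
        = 1 - 2 * C $$ (i, f i) + (\<Sum>k<K. (C $$ (i, k))\<^sup>2)" if "i < ?n" for i
    proof -
      have "(\<Sum>k<K. (of_bool (f i = k) - C $$ (i, k))\<^sup>2)
        = (\<Sum>k<K. (if k = f i then 1 - 2 * C $$ (i, k) else 0) + (C $$ (i, k))\<^sup>2)"
        by (intro sum.cong) (auto simp: power2_eq_square algebra_simps)
      then show ?thesis using f[OF that] by (simp add: sum.distrib)
    qed
    then have "(\<Sum>i<?n. \<Sum>k<K. (of_bool (f i = k) - C $$ (i, k))\<^sup>2)
        = (\<Sum>i<?n. 1 - 2 * C $$ (i, f i) + (\<Sum>k<K. (C $$ (i, k))\<^sup>2))"
      by (intro sum.cong) auto
    also have "\<dots> = real ?n - 2 * (\<Sum>i<?n. C $$ (i, f i)) + c"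
      by (simp add: sum.distrib sum_subtractf sum_distrib_left c_def)
    finally show ?thesis using C by (simp add: frob_norm_square)
  qed
  have "frob_norm (label_mat ?n K h - C) \<le> frob_norm (label_mat ?n K g - C)"
    using h(2) g(2) by (auto simp: proj_def is_arg_min_linorder)
  from power_mono[OF this frob_norm_nonneg, of 2] show ?thesis
    by (simp only: * h(1) g(1))
qed

section \<open>Contraction of the error set in one step\<close>

lemma mult_label_mat_index:
  assumes "A \<in> carrier_mat n n" "i < n" "k < K"
  shows "(A * label_mat n K h) $$ (i, k) = (\<Sum>j<n. A $$ (i, j) * of_bool (h j = k))"
  using assms by (simp add: scalar_prod_def lessThan_atLeast0)

definition separated :: "nat \<Rightarrow> nat \<Rightarrow> real \<Rightarrow> (nat \<Rightarrow> nat) \<Rightarrow> real mat \<Rightarrow> bool" where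
  "separated n K \<delta> g A \<longleftrightarrow> (\<forall>i<n. \<forall>l<K. l \<noteq> g i \<longrightarrow>
     (\<Sum>j<n. A $$ (i, j) * of_bool (g j = l)) + \<delta>
       \<le> (\<Sum>j<n. A $$ (i, j) * of_bool (g j = g i)))"

text \<open>The permuted truth nearest to the initial point depends on that point. Invariance under
  relabelling lets a single random event serve all permutations.\<close>

lemma separated_comp:
  assumes "separated n K \<delta> g A" "\<sigma> permutes {..<K}" "\<And>i. i < n \<Longrightarrow> g i < K"
  shows "separated n K \<delta> (\<sigma> \<circ> g) A"
  unfolding separated_def
proof (intro allI impI)
  fix i l assume i: "i < n" and l: "l < K" "l \<noteq> (\<sigma> \<circ> g) i"
  obtain l' where l': "l = \<sigma> l'" using permutes_surj[OF assms(2)] by (metis surjD)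
  have "l' < K" using permutes_in_image[OF assms(2), of l'] l l' by simp
  moreover have "\<sigma> x = \<sigma> y \<longleftrightarrow> x = y" for x y
    using permutes_inj[OF assms(2)] by (auto dest: injD)
  ultimately show "(\<Sum>j<n. A $$ (i, j) * of_bool ((\<sigma> \<circ> g) j = l)) + \<delta>
       \<le> (\<Sum>j<n. A $$ (i, j) * of_bool ((\<sigma> \<circ> g) j = (\<sigma> \<circ> g) i))"
    using assms(1) i l unfolding separated_def l' by simp
qed

text \<open>Optimality of \<open>h'\<close> against \<open>g\<close> involves only the vertices of
  \<open>?T\<close>, where the two differ. If \<open>h\<close> were \<open>g\<close>, each of them
  would lose at least \<delta>; the errors of \<open>h\<close> can give back at most twice the edges
  to \<open>?S\<close>.\<close>

lemma proj_mult_misfits: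
  assumes A: "A \<in> carrier_mat (m * K) (m * K)"
      "\<And>i j. i < m * K \<Longrightarrow> j < m * K \<Longrightarrow> A $$ (i, j) \<ge> 0"
    and g: "\<And>i. i < m * K \<Longrightarrow> g i < K" "label_mat (m * K) K g \<in> feasible_mats m K"
    and sep: "separated (m * K) K \<delta> g A"
    and h': "\<And>i. i < m * K \<Longrightarrow> h' i < K"
      "label_mat (m * K) K h' \<in> proj m K (A * label_mat (m * K) K h)"
  shows "\<delta> * real (card (misfits (m * K) h' g))
    \<le> 2 * (\<Sum>i\<in>misfits (m * K) h' g. \<Sum>j\<in>misfits (m * K) h g. A $$ (i, j))"
proof -
  define n where "n = m * K"
  let ?T = "misfits n h' g" and ?S = "misfits n h g"
  let ?b = "\<lambda>i f. (\<Sum>j<n. A $$ (i, j) * of_bool (h j = f i))"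
  have sub: "?T \<subseteq> {..<n}" "?S \<subseteq> {..<n}" by (auto simp: misfits_def)
  have carrier: "A * label_mat (m * K) K h \<in> carrier_mat (m * K) K"
    using A by (auto intro!: carrier_matI)
  have "(\<Sum>i<n. ?b i g) \<le> (\<Sum>i<n. ?b i h')"
    using proj_inner_mono[OF carrier h' g] mult_label_mat_index[OF A(1)] g(1) h'(1)
    by (simp add: n_def del: index_mult_mat sum_mult_of_bool_eq sum_of_bool_mult_eq)
  then have "0 \<le> (\<Sum>i<n. ?b i h' - ?b i g)" by (simp add: sum_subtractf)
  also have "\<dots> = (\<Sum>i\<in>?T. ?b i h' - ?b i g)"
    by (intro sum.mono_neutral_right) (auto simp: misfits_def)
  also have "\<dots> \<le> (\<Sum>i\<in>?T. - \<delta> + 2 * (\<Sum>j\<in>?S. A $$ (i, j)))"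
  proof (intro sum_mono)
    fix i assume i: "i \<in> ?T"
    then have i': "i < n" by (auto simp: misfits_def)
    have "?b i h' - ?b i g = (\<Sum>j<n. A $$ (i, j) * (of_bool (h j = h' i) - of_bool (h j = g i)))"
      by (simp add: sum_subtractf right_diff_distrib)
    \<comment> \<open>Outside \<open>?S\<close> the labels \<open>h j\<close> and \<open>g j\<close>
      agree. Inside, a difference of two indicators moves by at most 2, and \<open>A\<close> is
      nonnegative.\<close>
    also have "\<dots> \<le> (\<Sum>j<n. A $$ (i, j) * (of_bool (g j = h' i) - of_bool (g j = g i))
        + (if j \<in> ?S then 2 * A $$ (i, j) else 0))"
      using A(2)[of i] i' by (intro sum_mono) (auto simp: misfits_def n_def of_bool_def)
    also have "\<dots> = (\<Sum>j<n. A $$ (i, j) * of_bool (g j = h' i))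
        - (\<Sum>j<n. A $$ (i, j) * of_bool (g j = g i)) + (\<Sum>j\<in>?S. 2 * A $$ (i, j))"
      using sub(2) by (simp add: sum.distrib sum_subtractf right_diff_distrib sum.If_cases Int_absorb1)
    also have "\<dots> \<le> - \<delta> + 2 * (\<Sum>j\<in>?S. A $$ (i, j))"
      using sep i h'(1)[of i] by (auto simp: separated_def misfits_def n_def sum_distrib_left algebra_simps)
    finally show "?b i h' - ?b i g \<le> - \<delta> + 2 * (\<Sum>j\<in>?S. A $$ (i, j))" .
  qed
  also have "\<dots> = - \<delta> * real (card ?T) + 2 * (\<Sum>i\<in>?T. \<Sum>j\<in>?S. A $$ (i, j))"
    by (simp only: sum.distrib sum_distrib_left[symmetric]) (simp)
  finally show ?thesis by (simp add: n_def)
qed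

text \<open>All pairs \<open>(S, T)\<close> are covered because the error sets of the iterates
  depend on \<open>A\<close>. The condition linking \<open>c\<close> to the two sizes describes a
  step that fails to shrink the errors by the factor \<open>c\<close>.\<close>

definition locally_sparse :: "nat \<Rightarrow> real \<Rightarrow> real \<Rightarrow> real \<Rightarrow> real mat \<Rightarrow> bool" where
  "locally_sparse n \<epsilon> c \<delta> A \<longleftrightarrow> (\<forall>S T. S \<subseteq> {..<n} \<and> T \<subseteq> {..<n} \<and> S \<noteq> {} \<and> T \<noteq> {} \<and>
     real (card S) \<le> \<epsilon> * real n \<and> c * real (card S) \<le> real (card T) \<longrightarrow>
     2 * (\<Sum>i\<in>T. \<Sum>j\<in>S. A $$ (i, j)) < \<delta> * real (card T))"

text \<open>A new error set larger than \<open>c\<close> times the old one would have too few edges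
  to it to compensate the loss in degree.\<close>

lemma misfits_contract:
  assumes A: "A \<in> carrier_mat (m * K) (m * K)"
      "\<And>i j. i < m * K \<Longrightarrow> j < m * K \<Longrightarrow> A $$ (i, j) \<ge> 0"
    and g: "\<And>i. i < m * K \<Longrightarrow> g i < K" "label_mat (m * K) K g \<in> feasible_mats m K"
    and sep: "separated (m * K) K \<delta> g A" "\<delta> > 0"
    and sparse: "locally_sparse (m * K) \<epsilon> c \<delta> A" "c \<ge> 0"
    and h: "real (card (misfits (m * K) h g)) \<le> \<epsilon> * real (m * K)"
    and H: "H \<in> proj m K (A * label_mat (m * K) K h)"
  obtains h' where "\<And>i. i < m * K \<Longrightarrow> h' i < K" "H = label_mat (m * K) K h'"
    "real (card (misfits (m * K) h' g)) \<le> c * real (card (misfits (m * K) h g))"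
proof -
  have "H \<in> feasible_mats m K" using H by (auto simp: proj_def is_arg_min_linorder)
  then obtain h' where h': "\<And>i. i < m * K \<Longrightarrow> h' i < K" "H = label_mat (m * K) K h'"
    using feasible_label_mat by blast
  let ?S = "misfits (m * K) h g" and ?T = "misfits (m * K) h' g"
  have le: "\<delta> * real (card ?T) \<le> 2 * (\<Sum>i\<in>?T. \<Sum>j\<in>?S. A $$ (i, j))"
    using proj_mult_misfits[OF A g sep(1) h'(1)] H h'(2) by simp
  have "real (card ?T) \<le> c * real (card ?S)"
  proof (rule ccontr)
    assume gt: "\<not> ?thesis"
    have "0 \<le> c * real (card ?S)" using sparse(2) by simp
    with gt have T: "?T \<noteq> {}" by auto
    \<comment> \<open>Local sparsity speaks of nonempty sets only. Without old errors nothing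
      compensates the loss, so there are no new ones either.\<close>
    have S: "?S \<noteq> {}"
    proof
      assume "?S = {}"
      then have "\<delta> * real (card ?T) \<le> 0" using le by simp
      with sep(2) T show False by (simp add: mult_le_0_iff card_gt_0_iff)
    qed
    have "?S \<subseteq> {..<m * K}" "?T \<subseteq> {..<m * K}" by (auto simp: misfits_def)
    with S T gt sparse h have "2 * (\<Sum>i\<in>?T. \<Sum>j\<in>?S. A $$ (i, j)) < \<delta> * real (card ?T)"
      unfolding locally_sparse_def by (meson le_cases linorder_not_le order_less_imp_le)
    with le show False by simp
  qed
  then show ?thesis using that h' by blast
qed

section \<open>Errors and operations along the iteration\<close>

lemma spmm_eq:
  assumes "(B, s) = spmm A H" "dim_col A = dim_row H"
  shows "B = A * H"
    "s = 2 * dim_col H * card {(i, j). i < dim_row A \<and> j < dim_col A \<and> A $$ (i, j) \<noteq> 0}"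
  using fst_spmm[OF assms(2)] snd_spmm[of A H] assms(1) by (metis fst_conv, metis snd_conv)

text \<open>The factor 2 in the bound on \<open>h0\<close> pays for the first projection. As
  \<open>c \<le> 1\<close>, no iterate leaves the range of \<epsilon> n errors in which local
  sparsity applies.\<close>

lemma ppm_misfits:
  assumes A: "A \<in> carrier_mat (m * K) (m * K)"
      "\<And>i j. i < m * K \<Longrightarrow> j < m * K \<Longrightarrow> A $$ (i, j) \<ge> 0"
    and g: "\<And>i. i < m * K \<Longrightarrow> g i < K" "label_mat (m * K) K g \<in> feasible_mats m K"
    and sep: "separated (m * K) K \<delta> g A" "\<delta> > 0"
    and sparse: "locally_sparse (m * K) \<epsilon> c \<delta> A" "c \<ge> 0" "c \<le> 1"
    and h0: "\<And>i. i < m * K \<Longrightarrow> h0 i < K"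
      "2 * real (card (misfits (m * K) h0 g)) \<le> \<epsilon> * real (m * K)"
    and H: "(H, t) \<in> ppm cP m K A (label_mat (m * K) K h0) k"
  shows "\<exists>h. (\<forall>i<m * K. h i < K) \<and> H = label_mat (m * K) K h \<and>
    real (card (misfits (m * K) h g)) \<le> c ^ k * (\<epsilon> * real (m * K))"
  using H
proof (induction k arbitrary: H t)
  case 0
  then have "H \<in> proj m K (label_mat (m * K) K h0)" by (auto simp: timed_proj_def)
  then obtain h where h: "\<And>i. i < m * K \<Longrightarrow> h i < K" "H = label_mat (m * K) K h"
    "card (misfits (m * K) h g) \<le> 2 * card (misfits (m * K) h0 g)"
    using proj_label_mat[of H m K h0 g] h0(1) g by blast
  from h(3) have "real (card (misfits (m * K) h g)) \<le> 2 * real (card (misfits (m * K) h0 g))"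
    by linarith
  with h h0(2) show ?case by force
next
  case (Suc k)
  then obtain H1 t1 B s t' where *: "(H1, t1) \<in> ppm cP m K A (label_mat (m * K) K h0) k"
    "(B, s) = spmm A H1" "(H, t') \<in> timed_proj cP m K B" by auto
  from Suc.IH[OF *(1)] obtain h where h: "H1 = label_mat (m * K) K h"
    "real (card (misfits (m * K) h g)) \<le> c ^ k * (\<epsilon> * real (m * K))" by blast
  have "B = A * H1" using spmm_eq[OF *(2)] A(1) h(1) by simp
  then have H: "H \<in> proj m K (A * label_mat (m * K) K h)"
    using *(3) h(1) by (auto simp: timed_proj_def)
  have nonneg: "0 \<le> \<epsilon> * real (m * K)" using h0(2) by linarith
  have "c ^ k \<le> 1" using sparse by (simp add: power_le_one)
  then have "c ^ k * (\<epsilon> * real (m * K)) \<le> \<epsilon> * real (m * K)"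
    using mult_right_mono[OF _ nonneg, of "c ^ k" 1] by simp
  with h(2) have le: "real (card (misfits (m * K) h g)) \<le> \<epsilon> * real (m * K)" by linarith
  obtain h' where h': "\<And>i. i < m * K \<Longrightarrow> h' i < K" "H = label_mat (m * K) K h'"
    "real (card (misfits (m * K) h' g)) \<le> c * real (card (misfits (m * K) h g))"
    using misfits_contract[OF A g sep sparse(1,2) le H] by blast
  note h'(3)
  also have "c * real (card (misfits (m * K) h g)) \<le> c * (c ^ k * (\<epsilon> * real (m * K)))"
    using h(2) sparse(2) by (rule mult_left_mono)
  also have "\<dots> = c ^ Suc k * (\<epsilon> * real (m * K))" by simp
  finally show ?case using h'(1,2) by blast
qed

text \<open>There is one projection more than there are products. Feasibility is carried through the
  induction because the cost of a product depends on the number of columns of the iterate.\<close>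

lemma ppm_time:
  assumes A: "A \<in> carrier_mat (m * K) (m * K)"
    and N: "real (card {(i, j). i < m * K \<and> j < m * K \<and> A $$ (i, j) \<noteq> 0}) \<le> M"
    and H: "(H, t) \<in> ppm cP m K A H0 k"
  shows "H \<in> feasible_mats m K \<and> real t \<le> real (k + 1) * (cP * (real K)\<^sup>2 * real (m * K) * ln (real (m * K)))
    + real k * (2 * real K * M)"
  using H
proof (induction k arbitrary: H t)
  case 0
  then show ?case by (auto simp: timed_proj_def proj_def is_arg_min_linorder)
next
  case (Suc k)
  then obtain H1 t1 B s t' where *: "(H1, t1) \<in> ppm cP m K A H0 k"
    "(B, s) = spmm A H1" "(H, t') \<in> timed_proj cP m K B" "t = t1 + s + t'" by auto
  note IH = Suc.IH[OF *(1)]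
  then have dim: "dim_row H1 = m * K" "dim_col H1 = K" by (auto simp: feasible_mats_def)
  have s: "real s = 2 * real K * real (card {(i, j). i < m * K \<and> j < m * K \<and> A $$ (i, j) \<noteq> 0})"
    using spmm_eq(2)[OF *(2)] A dim by simp
  have "real s \<le> 2 * real K * M" unfolding s using N by (intro mult_left_mono) auto
  moreover have "real t' \<le> cP * (real K)\<^sup>2 * real (m * K) * ln (real (m * K))" "H \<in> feasible_mats m K"
    using *(3) by (auto simp: timed_proj_def proj_def is_arg_min_linorder)
  moreover have "real t = real t1 + real s + real t'" using *(4) by simp
  ultimately show ?case using IH by (simp add: algebra_simps)
qed

subsection \<open>Chernoff bounds for the edges\<close>

text \<open>Chernoff's method: Markov's inequality for the exponential, independence, and
  \<open>1 + x \<le> exp x\<close>. The tilt is absorbed in the weights \<open>w\<close>, which may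
  have either sign.\<close>

lemma prob_Pi_bernoulli_sum_ge:
  fixes P :: "'a \<Rightarrow> real" and w :: "'a \<Rightarrow> real"
  assumes "finite D" and P: "\<And>x. x \<in> D \<Longrightarrow> 0 \<le> P x \<and> P x \<le> 1"
  shows "measure_pmf.prob (Pi_pmf D dflt (\<lambda>x. bernoulli_pmf (P x)))
      {e. b \<le> (\<Sum>x\<in>D. w x * of_bool (e x))} \<le> exp ((\<Sum>x\<in>D. P x * (exp (w x) - 1)) - b)"
proof -
  let ?M = "Pi_pmf D dflt (\<lambda>x. bernoulli_pmf (P x))"
  let ?Y = "\<lambda>e. \<Prod>x\<in>D. exp (w x * of_bool (e x)) :: real"
  have int: "integrable (measure_pmf ?M) ?Y"
    using assms(1) by (intro integrable_prod_Pi_pmf) (auto intro: integrable_measure_pmf_finite)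
  have "{e. b \<le> (\<Sum>x\<in>D. w x * of_bool (e x))} = {e \<in> space (measure_pmf ?M). exp b \<le> ?Y e}"
    by (simp add: exp_sum[OF assms(1), symmetric])
  also have "measure_pmf.prob ?M \<dots> \<le> measure_pmf.expectation ?M ?Y / exp b"
    by (rule integral_Markov_inequality_measure[where A = UNIV, OF int]) (auto intro!: prod_nonneg)
  also have "measure_pmf.expectation ?M ?Y = (\<Prod>x\<in>D. 1 + P x * (exp (w x) - 1))"
  proof -
    have "measure_pmf.expectation ?M ?Y
        = (\<Prod>x\<in>D. measure_pmf.expectation (bernoulli_pmf (P x)) (\<lambda>v. exp (w x * of_bool v)))"
      using assms(1) by (intro expectation_prod_Pi_pmf) (auto intro: integrable_measure_pmf_finite)
    also have "\<dots> = (\<Prod>x\<in>D. 1 + P x * (exp (w x) - 1))"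
      using P by (intro prod.cong) (auto simp: algebra_simps)
    finally show ?thesis .
  qed
  also have "(\<Prod>x\<in>D. 1 + P x * (exp (w x) - 1)) \<le> (\<Prod>x\<in>D. exp (P x * (exp (w x) - 1)))"
  proof (intro prod_mono conjI)
    fix x assume "x \<in> D"
    then have "0 \<le> (1 - P x) + P x * exp (w x)" using P[of x] by (intro add_nonneg_nonneg) auto
    then show "0 \<le> 1 + P x * (exp (w x) - 1)" by (simp add: algebra_simps)
  qed simp
  also have "\<dots> = exp (\<Sum>x\<in>D. P x * (exp (w x) - 1))"
    by (simp add: exp_sum[OF assms(1)])
  finally show ?thesis by (simp add: exp_diff divide_right_mono)
qed

text \<open>Variables outside the image of \<open>\<phi>\<close> get weight 0 and contribute
  \<open>exp 0 - 1 = 0\<close> to the exponent.\<close>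

lemma prob_Pi_bernoulli_sum_ge_reindexed:
  fixes P :: "'a \<Rightarrow> real" and v :: "'b \<Rightarrow> real"
  assumes "finite D" and P: "\<And>x. x \<in> D \<Longrightarrow> 0 \<le> P x \<and> P x \<le> 1"
    and \<phi>: "inj_on \<phi> J" "\<phi> ` J \<subseteq> D"
  shows "measure_pmf.prob (Pi_pmf D dflt (\<lambda>x. bernoulli_pmf (P x)))
      {e. b \<le> (\<Sum>j\<in>J. v j * of_bool (e (\<phi> j)))} \<le> exp ((\<Sum>j\<in>J. P (\<phi> j) * (exp (v j) - 1)) - b)"
proof -
  define w where "w x = (if x \<in> \<phi> ` J then v (the_inv_into J \<phi> x) else 0)" for x
  have w: "w (\<phi> j) = v j" if "j \<in> J" for j
    using that \<phi>(1) by (simp add: w_def the_inv_into_f_f)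
  have w0: "w x = 0" if "x \<notin> \<phi> ` J" for x using that by (simp add: w_def)
  have "(\<Sum>x\<in>D. w x * f x) = (\<Sum>j\<in>J. v j * f (\<phi> j))" for f
  proof -
    have "(\<Sum>x\<in>D. w x * f x) = (\<Sum>x\<in>\<phi> ` J. w x * f x)"
      using assms(1) \<phi>(2) w0 by (intro sum.mono_neutral_right) auto
    also have "\<dots> = (\<Sum>j\<in>J. v j * f (\<phi> j))"
      using w by (simp add: sum.reindex[OF \<phi>(1)])
    finally show ?thesis .
  qed
  moreover have "(\<Sum>x\<in>D. P x * (exp (w x) - 1)) = (\<Sum>j\<in>J. P (\<phi> j) * (exp (v j) - 1))"
  proof -
    have "(\<Sum>x\<in>D. P x * (exp (w x) - 1)) = (\<Sum>x\<in>\<phi> ` J. P x * (exp (w x) - 1))"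
      using assms(1) \<phi>(2) w0 by (intro sum.mono_neutral_right) auto
    also have "\<dots> = (\<Sum>j\<in>J. P (\<phi> j) * (exp (v j) - 1))"
      using w by (simp add: sum.reindex[OF \<phi>(1)])
    finally show ?thesis .
  qed
  ultimately show ?thesis using prob_Pi_bernoulli_sum_ge[of D P dflt b w] assms(1) P by simp
qed

section \<open>Matrix entries in terms of independent edge variables\<close>

definition upper_pairs :: "nat \<Rightarrow> (nat \<times> nat) set" where
  "upper_pairs n = {(i, j). i \<le> j \<and> j < n}"

lemma finite_upper_pairs [simp]: "finite (upper_pairs n)"
  by (rule finite_subset[of _ "{..<n} \<times> {..<n}"]) (auto simp: upper_pairs_def)

text \<open>The position in the upper triangle whose variable determines both symmetric
  entries.\<close>

definition ordered_pair :: "nat \<times> nat \<Rightarrow> nat \<times> nat" where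
  "ordered_pair = (\<lambda>(i, j). (min i j, max i j))"

lemma ordered_pair_in_upper_pairs: "i < n \<Longrightarrow> j < n \<Longrightarrow> ordered_pair (i, j) \<in> upper_pairs n"
  by (auto simp: ordered_pair_def upper_pairs_def)

text \<open>The entries of one row are therefore independent, so degrees obey a Chernoff bound
  without the loss caused by symmetry. The sharp threshold relies on this.\<close>

lemma inj_ordered_pair: "inj (\<lambda>j. ordered_pair (i, j))"
  by (auto simp: inj_def ordered_pair_def min_def max_def split: if_splits)

definition edge_mat :: "nat \<Rightarrow> (nat \<times> nat \<Rightarrow> bool) \<Rightarrow> real mat" where
  "edge_mat n e = Matrix.mat n n (\<lambda>(i, j). of_bool (e (ordered_pair (i, j))))"

lemma edge_mat_carrier [simp]: "edge_mat n e \<in> carrier_mat n n"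
  by (simp add: edge_mat_def)

lemma edge_mat_index: "i < n \<Longrightarrow> j < n \<Longrightarrow> edge_mat n e $$ (i, j) = of_bool (e (ordered_pair (i, j)))"
  by (simp add: edge_mat_def)

text \<open>A fibre of \<open>ordered_pair\<close> has at most two elements, a pair and its mirror
  image.\<close>

lemma sum_ordered_pair_le:
  fixes f :: "nat \<times> nat \<Rightarrow> real"
  assumes "finite Z" "\<And>x. f x \<ge> 0"
  shows "(\<Sum>z\<in>Z. f (ordered_pair z)) \<le> 2 * (\<Sum>x\<in>ordered_pair ` Z. f x)"
    and "(\<Sum>x\<in>ordered_pair ` Z. f x) \<le> (\<Sum>z\<in>Z. f (ordered_pair z))"
proof -
  let ?F = "\<lambda>x. {z \<in> Z. ordered_pair z = x}"
  have eq: "(\<Sum>z\<in>Z. f (ordered_pair z)) = (\<Sum>x\<in>ordered_pair ` Z. real (card (?F x)) * f x)"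
    by (subst sum.image_gen[OF assms(1), of _ ordered_pair]) simp
  have 2: "card (?F x) \<le> 2" for x
  proof -
    have "?F x \<subseteq> {x, (snd x, fst x)}"
      by (auto simp: ordered_pair_def min_def max_def split: if_splits)
    then have "card (?F x) \<le> card {x, (snd x, fst x)}" by (intro card_mono) auto
    also have "\<dots> \<le> 2" by (simp add: card_insert_if)
    finally show ?thesis .
  qed
  have "(\<Sum>x\<in>ordered_pair ` Z. real (card (?F x)) * f x) \<le> (\<Sum>x\<in>ordered_pair ` Z. 2 * f x)"
  proof (intro sum_mono mult_right_mono)
    fix x show "real (card (?F x)) \<le> 2" using 2[of x] by linarith
  qed (rule assms(2))
  then show "(\<Sum>z\<in>Z. f (ordered_pair z)) \<le> 2 * (\<Sum>x\<in>ordered_pair ` Z. f x)"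
    by (simp add: eq sum_distrib_left)
  have "(\<Sum>x\<in>ordered_pair ` Z. 1 * f x) \<le> (\<Sum>x\<in>ordered_pair ` Z. real (card (?F x)) * f x)"
  proof (intro sum_mono mult_right_mono)
    fix x assume "x \<in> ordered_pair ` Z"
    then have "?F x \<noteq> {}" by auto
    then have "card (?F x) \<noteq> 0" using assms(1) by simp
    then show "1 \<le> real (card (?F x))" by linarith
  qed (rule assms(2))
  then show "(\<Sum>x\<in>ordered_pair ` Z. f x) \<le> (\<Sum>z\<in>Z. f (ordered_pair z))"
    by (simp add: eq)
qed

text \<open>\<open>S\<close> and \<open>T\<close> may overlap, and then some edges occur twice in
  the block. Passing to distinct edges halves the threshold, whence
  \<open>w * b / 2\<close>.\<close>

lemma prob_edges_between_ge:
  assumes P: "\<And>x. 0 \<le> P x \<and> P x \<le> 1" and ST: "S \<subseteq> {..<n}" "T \<subseteq> {..<n}" and w: "w \<ge> 0"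
  shows "measure_pmf.prob (Pi_pmf (upper_pairs n) False (\<lambda>x. bernoulli_pmf (P x)))
      {e. b \<le> (\<Sum>i\<in>T. \<Sum>j\<in>S. edge_mat n e $$ (i, j))}
    \<le> exp ((\<Sum>i\<in>T. \<Sum>j\<in>S. P (ordered_pair (i, j))) * (exp w - 1) - w * b / 2)"
proof -
  let ?M = "Pi_pmf (upper_pairs n) False (\<lambda>x. bernoulli_pmf (P x))"
  let ?E = "ordered_pair ` (T \<times> S)"
  have fin: "finite (T \<times> S)" using ST by (auto intro: finite_subset)
  have sub: "?E \<subseteq> upper_pairs n"
    using ST by (auto intro!: ordered_pair_in_upper_pairs)
  have "{e. b \<le> (\<Sum>i\<in>T. \<Sum>j\<in>S. edge_mat n e $$ (i, j))}
      \<subseteq> {e. w * b / 2 \<le> (\<Sum>x\<in>?E. w * of_bool (e (id x)))}"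
  proof clarify
    fix e assume "b \<le> (\<Sum>i\<in>T. \<Sum>j\<in>S. edge_mat n e $$ (i, j))"
    also have "\<dots> = (\<Sum>i\<in>T. \<Sum>j\<in>S. of_bool (e (ordered_pair (i, j))))"
      using ST by (intro sum.cong) (auto simp: edge_mat_index subset_iff)
    also have "\<dots> = (\<Sum>z\<in>T \<times> S. of_bool (e (ordered_pair z)))"
      by (simp add: sum.cartesian_product)
    also have "\<dots> \<le> 2 * (\<Sum>x\<in>?E. of_bool (e x))"
      by (rule sum_ordered_pair_le(1)[OF fin]) simp
    finally have "b \<le> 2 * (\<Sum>x\<in>?E. of_bool (e x))" .
    from mult_left_mono[OF this w] show "w * b / 2 \<le> (\<Sum>x\<in>?E. w * of_bool (e (id x)))"
      by (simp only: sum_distrib_left[symmetric] id_apply)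
  qed
  then have "measure_pmf.prob ?M {e. b \<le> (\<Sum>i\<in>T. \<Sum>j\<in>S. edge_mat n e $$ (i, j))}
      \<le> measure_pmf.prob ?M {e. w * b / 2 \<le> (\<Sum>x\<in>?E. w * of_bool (e (id x)))}"
    by (intro measure_pmf.finite_measure_mono) auto
  also have "\<dots> \<le> exp ((\<Sum>x\<in>?E. P (id x) * (exp w - 1)) - w * b / 2)"
    using sub P by (intro prob_Pi_bernoulli_sum_ge_reindexed) auto
  also have "(\<Sum>x\<in>?E. P (id x) * (exp w - 1)) = (\<Sum>x\<in>?E. P x) * (exp w - 1)"
    by (simp add: sum_distrib_right)
  also have "(\<Sum>x\<in>?E. P x) * (exp w - 1) \<le> (\<Sum>z\<in>T \<times> S. P (ordered_pair z)) * (exp w - 1)"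
    using sum_ordered_pair_le(2)[OF fin, of P] P w by (intro mult_right_mono) auto
  also have "(\<Sum>z\<in>T \<times> S. P (ordered_pair z)) = (\<Sum>i\<in>T. \<Sum>j\<in>S. P (ordered_pair (i, j)))"
    by (simp add: sum.cartesian_product)
  finally show ?thesis by simp
qed

section \<open>Union bound over pairs of vertex sets\<close>

text \<open>One term of the expansion of \<open>(1 + x) ^ n\<close> at \<open>x = s / n\<close> is
  at most the whole, which is at most \<open>exp s\<close>.\<close>

lemma binomial_le_exp:
  assumes "0 < s" "s \<le> n"
  shows "real (n choose s) \<le> exp (real s * (1 + ln (real n / real s)))"
proof -
  define x where "x = real s / real n"
  have x: "x > 0" using assms by (simp add: x_def)
  have "real (n choose s) * x ^ s \<le> (\<Sum>k\<le>n. real (n choose k) * x ^ k)"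
    using assms x by (intro member_le_sum) auto
  also have "\<dots> = (1 + x) ^ n" using binomial_ring[of x 1 n] by (simp add: add.commute)
  also have "\<dots> \<le> exp x ^ n" using x by (intro power_mono) auto
  also have "\<dots> = exp (real s)" using assms by (simp add: exp_of_nat_mult[symmetric] x_def)
  finally have "real (n choose s) \<le> exp (real s) * (1 / x) ^ s"
    using x by (simp add: field_simps)
  also have "(1 / x) ^ s = exp (real s * ln (1 / x))" using x by (simp add: exp_of_nat_mult)
  also have "1 / x = real n / real s" by (simp add: x_def)
  finally show ?thesis by (simp add: exp_add[symmetric] algebra_simps)
qed

text \<open>The sets are grouped by cardinality; at most \<open>n\<close> cardinalities occur, and
  each contributes at most \<open>b\<close>.\<close>

lemma sum_subsets_le:
  fixes F :: "nat \<Rightarrow> real"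
  assumes "\<And>s. F s \<ge> 0"
    and "\<And>s. 1 \<le> s \<Longrightarrow> s \<le> n \<Longrightarrow> real s \<le> r \<Longrightarrow> real (n choose s) * F s \<le> b" and "b \<ge> 0"
  shows "(\<Sum>S | S \<subseteq> {..<n} \<and> S \<noteq> {} \<and> real (card S) \<le> r. F (card S)) \<le> real n * b"
proof -
  let ?Q = "{S. S \<subseteq> {..<n} \<and> S \<noteq> {} \<and> real (card S) \<le> r}"
  have fin: "finite ?Q" by (rule finite_subset[of _ "Pow {..<n}"]) auto
  have "card ` ?Q \<subseteq> {1..n}"
  proof clarify
    fix S assume S: "S \<subseteq> {..<n}" "S \<noteq> {}"
    then have "finite S" by (auto intro: finite_subset)
    with S show "card S \<in> {1..n}"
      using card_mono[of "{..<n}" S] by (simp add: Suc_le_eq card_gt_0_iff)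
  qed
  then have "(\<Sum>S\<in>?Q. F (card S)) = (\<Sum>s\<in>{1..n}. \<Sum>S\<in>{S \<in> ?Q. card S = s}. F (card S))"
    by (intro sum.group[symmetric] fin) auto
  also have "\<dots> \<le> (\<Sum>s\<in>{1..n}. b)"
  proof (intro sum_mono)
    fix s assume s: "s \<in> {1..n}"
    show "(\<Sum>S\<in>{S \<in> ?Q. card S = s}. F (card S)) \<le> b"
    proof (cases "real s \<le> r")
      case True
      have "(\<Sum>S\<in>{S \<in> ?Q. card S = s}. F (card S)) \<le> (\<Sum>S | S \<subseteq> {..<n} \<and> card S = s. F (card S))"
        using assms(1) by (intro sum_mono2) auto
      also have "\<dots> = real (n choose s) * F s"
        using n_subsets[of "{..<n}" s] by simp
      also have "\<dots> \<le> b" using s True by (intro assms(2)) auto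
      finally show ?thesis .
    next
      case False
      then have empty: "{S \<in> ?Q. card S = s} = {}" by auto
      show ?thesis unfolding empty using assms(3) by simp
    qed
  qed
  also have "\<dots> = real n * b" by simp
  finally show ?thesis .
qed

text \<open>Union bound over all pairs \<open>(S, T)\<close>. With \<open>L = ln (n / card S)\<close> there are at most
  \<open>exp (2 card S L) n\<^bsup>card T\<^esup>\<close> of them for given cardinalities. Tilting by \<open>L / 2\<close> makes the Chernoff
  exponent of order \<open>L \<gamma> ln n card T\<close>, which wins because \<open>L\<close> is large.\<close>

lemma prob_not_locally_sparse:
  assumes P: "\<And>x. 0 \<le> P x \<and> P x \<le> \<alpha> * ln (real n) / real n" and le1: "\<alpha> * ln (real n) / real n \<le> 1"
    and \<alpha>: "\<alpha> > 0" and \<gamma>: "\<gamma> > 0" and n: "n \<ge> 2"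
    and \<epsilon>: "0 < \<epsilon>" "\<epsilon> \<le> exp (- 1)" "\<epsilon> \<le> exp (- (16 * (\<alpha> + 4) / \<gamma>))"
  shows "measure_pmf.prob (Pi_pmf (upper_pairs n) False (\<lambda>x. bernoulli_pmf (P x)))
    {e. \<not> locally_sparse n \<epsilon> (32 / (\<gamma> * ln (real n))) (\<gamma> * ln (real n)) (edge_mat n e)} \<le> 1 / real n"
proof -
  let ?M = "Pi_pmf (upper_pairs n) False (\<lambda>x. bernoulli_pmf (P x))"
  define l where "l = ln (real n)"
  have l: "l > 0" and exp_l: "exp l = real n" using n by (auto simp: l_def)
  define QS where "QS = {S. S \<subseteq> {..<n} \<and> S \<noteq> {} \<and> real (card S) \<le> \<epsilon> * real n}"
  \<comment> \<open>The cap at \<open>n\<close> gives this family the shape required by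
    \<open>sum_subsets_le\<close>.\<close>
  define QT where "QT = {T. T \<subseteq> {..<n} \<and> T \<noteq> {} \<and> real (card T) \<le> real n}"
  define Q where "Q = {(S, T) \<in> QS \<times> QT. 32 / (\<gamma> * l) * real (card S) \<le> real (card T)}"
  have finQ: "finite QS" "finite QT"
    unfolding QS_def QT_def by (auto intro: finite_subset[of _ "Pow {..<n}"])
  then have fin: "finite Q" by (auto simp: Q_def intro: finite_subset[of _ "QS \<times> QT"])
  define bad where "bad z = {e. \<gamma> * l * real (card (snd z)) / 2
      \<le> (\<Sum>i\<in>snd z. \<Sum>j\<in>fst z. edge_mat n e $$ (i, j))}" for z
  \<comment> \<open>\<open>F\<close> offsets the number of sets \<open>S\<close>, at most
    \<open>exp (2 s L)\<close>. \<open>G\<close> equals \<open>n\<close> to the power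
    \<open>-4t\<close>, which offsets the \<open>n ^ t\<close> sets \<open>T\<close> and leaves
    \<open>n\<close> to the power \<open>-3t\<close>.\<close>
  define F where "F s = exp (- 2 * real s * ln (real n / real s))" for s :: nat
  define G where "G t = exp (- 4 * l * real t)" for t :: nat
  have bad: "measure_pmf.prob ?M (bad z) \<le> F (card (fst z)) * G (card (snd z))" if "z \<in> Q" for z
  proof -
    obtain S T where z: "z = (S, T)" by (cases z)
    define s where "s = real (card S)"
    define t where "t = real (card T)"
    from that z have ST: "S \<subseteq> {..<n}" "S \<noteq> {}" "T \<subseteq> {..<n}" "T \<noteq> {}" "s \<le> \<epsilon> * real n"
        "32 / (\<gamma> * l) * s \<le> t"
      by (auto simp: Q_def QS_def QT_def s_def t_def)
    have finST: "finite S" "finite T" using ST by (auto intro: finite_subset)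
    with ST have s: "s > 0" and t: "t > 0" by (auto simp: s_def t_def card_gt_0_iff)
    define L where "L = ln (real n / s)"
    have ns: "real n / s \<ge> 1 / \<epsilon>" using ST(5) s \<epsilon>(1) by (simp add: field_simps)
    have "1 / \<epsilon> \<ge> exp 1" "1 / \<epsilon> \<ge> exp (16 * (\<alpha> + 4) / \<gamma>)"
      using \<epsilon> by (auto simp: exp_minus field_simps)
    with ns have ns': "real n / s \<ge> exp 1" "real n / s \<ge> exp (16 * (\<alpha> + 4) / \<gamma>)" by linarith+
    have pos: "real n / s > 0" using n s by simp
    have L: "L \<ge> 1" "L \<ge> 16 * (\<alpha> + 4) / \<gamma>"
      using ns' pos unfolding L_def by (simp_all add: ln_ge_iff)
    have "measure_pmf.prob ?M (bad z)
        \<le> exp ((\<Sum>i\<in>T. \<Sum>j\<in>S. P (ordered_pair (i, j))) * (exp (L / 2) - 1) - L / 2 * (\<gamma> * l * t / 2) / 2)"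
      unfolding bad_def z fst_conv snd_conv t_def
    proof (rule prob_edges_between_ge)
      show "0 \<le> P x \<and> P x \<le> 1" for x using P[of x] le1 by linarith
    qed (use L ST in auto)
    also have "\<dots> \<le> exp (- 2 * s * L - 4 * l * t)"
    proof -
      have "(\<Sum>i\<in>T. \<Sum>j\<in>S. P (ordered_pair (i, j))) \<le> (\<Sum>i\<in>T. \<Sum>j\<in>S. \<alpha> * l / real n)"
        using P unfolding l_def by (intro sum_mono) auto
      also have "\<dots> = t * s * (\<alpha> * l / real n)" by (simp add: s_def t_def)
      finally have "(\<Sum>i\<in>T. \<Sum>j\<in>S. P (ordered_pair (i, j))) * (exp (L / 2) - 1)
          \<le> t * s * (\<alpha> * l / real n) * (exp (L / 2) - 1)"
        using L by (intro mult_right_mono) auto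
      \<comment> \<open>Under this tilt the growth factor stays below \<open>n / s\<close>, so the
        size of \<open>S\<close> cancels from the mean.\<close>
      also have "\<dots> \<le> t * s * (\<alpha> * l / real n) * (real n / s)"
      proof (intro mult_left_mono)
        have "exp (L / 2) \<le> exp L" using L by simp
        also have "exp L = real n / s" using pos by (simp add: L_def)
        finally show "exp (L / 2) - 1 \<le> real n / s" by simp
      qed (use s t l \<alpha> in auto)
      also have "\<dots> = \<alpha> * l * t" using s n by (simp add: field_simps)
      finally have 1: "(\<Sum>i\<in>T. \<Sum>j\<in>S. P (ordered_pair (i, j))) * (exp (L / 2) - 1) \<le> \<alpha> * l * t" .
      \<comment> \<open>The gain \<open>L * \<gamma> * l * t / 8\<close> is split into two equal
        parts. The constant 32 in the size condition lets one part cover \<open>2 * s * L\<close>;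
        the lower bound on \<open>L\<close> lets the other cover the mean and
        \<open>4 * l * t\<close>.\<close>
      have "32 * s \<le> \<gamma> * l * t" using ST(6) \<gamma> l by (simp add: field_simps)
      then have "32 * s * (L / 16) \<le> \<gamma> * l * t * (L / 16)" using L by (intro mult_right_mono) auto
      then have 2: "2 * s * L \<le> L * \<gamma> * l * t / 16" by (simp add: mult_ac)
      have "16 * (\<alpha> + 4) \<le> L * \<gamma>" using L(2) \<gamma> by (simp add: field_simps)
      then have "16 * (\<alpha> + 4) * (l * t) \<le> L * \<gamma> * (l * t)" using l t by (intro mult_right_mono) auto
      then have 3: "(\<alpha> + 4) * (l * t) \<le> L * \<gamma> * l * t / 16" by (simp add: mult_ac)
      have "(\<alpha> + 4) * (l * t) = \<alpha> * l * t + 4 * l * t" by (simp add: algebra_simps)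
      moreover have "L / 2 * (\<gamma> * l * t / 2) / 2 = L * \<gamma> * l * t / 16 + L * \<gamma> * l * t / 16" by simp
      ultimately show ?thesis using 1 2 3 by (simp only: exp_le_cancel_iff)
    qed
    also have "\<dots> = F (card (fst z)) * G (card (snd z))"
      by (simp add: F_def G_def z s_def t_def L_def exp_add[symmetric])
    finally show ?thesis .
  qed
  have "{e. \<not> locally_sparse n \<epsilon> (32 / (\<gamma> * ln (real n))) (\<gamma> * ln (real n)) (edge_mat n e)}
      \<subseteq> (\<Union>z\<in>Q. bad z)"
  proof clarify
    fix e assume "\<not> locally_sparse n \<epsilon> (32 / (\<gamma> * ln (real n))) (\<gamma> * ln (real n)) (edge_mat n e)"
    then obtain S T where ST: "S \<subseteq> {..<n}" "T \<subseteq> {..<n}" "S \<noteq> {}" "T \<noteq> {}"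
      "real (card S) \<le> \<epsilon> * real n" "32 / (\<gamma> * l) * real (card S) \<le> real (card T)"
      "\<not> 2 * (\<Sum>i\<in>T. \<Sum>j\<in>S. edge_mat n e $$ (i, j)) < \<gamma> * l * real (card T)"
      unfolding locally_sparse_def l_def by blast
    have "card T \<le> n" using card_mono[OF _ ST(2)] by simp
    then have "(S, T) \<in> Q" using ST by (auto simp: Q_def QS_def QT_def)
    moreover have "e \<in> bad (S, T)" using ST(7) by (simp add: bad_def)
    ultimately show "e \<in> (\<Union>z\<in>Q. bad z)" by blast
  qed
  then have "measure_pmf.prob ?M
      {e. \<not> locally_sparse n \<epsilon> (32 / (\<gamma> * ln (real n))) (\<gamma> * ln (real n)) (edge_mat n e)}
      \<le> measure_pmf.prob ?M (\<Union>z\<in>Q. bad z)"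
    by (intro measure_pmf.finite_measure_mono) auto
  also have "\<dots> \<le> (\<Sum>z\<in>Q. measure_pmf.prob ?M (bad z))"
    using fin by (intro measure_pmf.finite_measure_subadditive_finite) auto
  also have "\<dots> \<le> (\<Sum>z\<in>Q. F (card (fst z)) * G (card (snd z)))"
    using bad by (intro sum_mono) auto
  \<comment> \<open>Dropping the size condition that couples \<open>S\<close> and \<open>T\<close>
    makes the sum factor.\<close>
  also have "\<dots> \<le> (\<Sum>z\<in>QS \<times> QT. F (card (fst z)) * G (card (snd z)))"
    using finQ by (intro sum_mono2) (auto simp: Q_def F_def G_def)
  also have "\<dots> = (\<Sum>S\<in>QS. F (card S)) * (\<Sum>T\<in>QT. G (card T))"
    by (simp add: sum_product sum.cartesian_product case_prod_unfold)
  also have "\<dots> \<le> (real n * 1) * (real n * (1 / real n ^ 3))"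
  proof (intro mult_mono)
    show "(\<Sum>S\<in>QS. F (card S)) \<le> real n * 1"
      unfolding QS_def
    proof (rule sum_subsets_le)
      fix s :: nat assume s: "1 \<le> s" "s \<le> n" "real s \<le> \<epsilon> * real n"
      have "real n / real s \<ge> 1 / \<epsilon>" using s \<epsilon>(1) by (simp add: field_simps)
      moreover have "1 / \<epsilon> \<ge> exp 1" using \<epsilon> by (auto simp: exp_minus field_simps)
      ultimately have "real n / real s \<ge> exp 1" by linarith
      then have L: "ln (real n / real s) \<ge> 1" using s by (subst ln_ge_iff) auto
      have "real (n choose s) \<le> exp (real s * (1 + ln (real n / real s)))"
        using s by (intro binomial_le_exp) auto
      also have "\<dots> \<le> exp (real s * (2 * ln (real n / real s)))"
        using L by (simp add: mult_left_mono)
      finally have "real (n choose s) * F s \<le> exp (real s * (2 * ln (real n / real s))) * F s"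
        by (intro mult_right_mono) (auto simp: F_def)
      also have "\<dots> = 1" by (simp add: F_def exp_add[symmetric])
      finally show "real (n choose s) * F s \<le> 1" .
    qed (auto simp: F_def)
    show "(\<Sum>T\<in>QT. G (card T)) \<le> real n * (1 / real n ^ 3)"
      unfolding QT_def
    proof (rule sum_subsets_le)
      fix t :: nat assume t: "1 \<le> t" "t \<le> n"
      have "G t = (1 / real n ^ 4) ^ t"
      proof -
        have "G t = exp (real t * (- (4 * l)))" by (simp add: G_def)
        also have "\<dots> = exp (- (real 4 * l)) ^ t" by (subst exp_of_nat_mult) simp
        also have "exp (- (real 4 * l)) = 1 / real n ^ 4"
          by (simp only: exp_minus exp_of_nat_mult exp_l) (simp add: field_simps)
        finally show ?thesis .
      qed
      moreover have "real (n choose t) \<le> real n ^ t"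
        using binomial_le_pow[OF t(2)] by (metis of_nat_le_iff of_nat_power)
      ultimately have "real (n choose t) * G t \<le> real n ^ t * (1 / real n ^ 4) ^ t"
        by (simp add: mult_right_mono)
      also have "\<dots> = (real n * (1 / real n ^ 4)) ^ t"
        by (simp only: power_mult_distrib)
      also have "real n * (1 / real n ^ 4) = 1 / real n ^ 3"
      proof -
        have "real n ^ 4 = real n * real n ^ 3" by (simp add: numeral_eq_Suc)
        then show ?thesis using n by simp
      qed
      also have "(1 / real n ^ 3) ^ t \<le> (1 / real n ^ 3) ^ 1"
        using t n by (intro power_decreasing) auto
      finally show "real (n choose t) * G t \<le> 1 / real n ^ 3" by simp
    qed (auto simp: G_def)
  qed (auto simp: G_def intro!: sum_nonneg)
  also have "\<dots> = 1 / real n" using n by (simp add: power3_eq_cube)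
  finally show ?thesis .
qed

subsection \<open>The three random events and the iteration\<close>

definition pair_prob :: "(nat \<Rightarrow> nat) \<Rightarrow> real \<Rightarrow> real \<Rightarrow> nat \<times> nat \<Rightarrow> real" where
  "pair_prob g p q x = (if g (fst x) = g (snd x) then p else q)"

lemma pair_prob_ordered_pair: "pair_prob g p q (ordered_pair (i, j)) = (if g i = g j then p else q)"
  by (auto simp: pair_prob_def ordered_pair_def min_def max_def)

lemma row_label_mat_eq_iff:
  assumes "i < n" "j < n" "g i < K"
  shows "Matrix.row (label_mat n K g) i = Matrix.row (label_mat n K g) j \<longleftrightarrow> g i = g j"
proof
  assume "Matrix.row (label_mat n K g) i = Matrix.row (label_mat n K g) j"
  then have "Matrix.row (label_mat n K g) i $ g i = Matrix.row (label_mat n K g) j $ g i" by simp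
  then show "g i = g j" using assms by (simp add: of_bool_def split: if_splits)
next
  assume "g i = g j"
  then show "Matrix.row (label_mat n K g) i = Matrix.row (label_mat n K g) j"
    using assms by (intro eq_vecI) auto
qed

text \<open>Rows agree exactly when labels do. This exposes the product measure to which the
  Chernoff bounds apply.\<close>

lemma sbm_pmf_label_mat:
  assumes "\<And>i. i < n \<Longrightarrow> g i < K"
  shows "sbm_pmf n p q (label_mat n K g)
    = map_pmf (edge_mat n) (Pi_pmf (upper_pairs n) False (\<lambda>x. bernoulli_pmf (pair_prob g p q x)))"
proof -
  have "Pi_pmf (upper_pairs n) False (\<lambda>(i, j). bernoulli_pmf
        (if Matrix.row (label_mat n K g) i = Matrix.row (label_mat n K g) j then p else q))
      = Pi_pmf (upper_pairs n) False (\<lambda>x. bernoulli_pmf (pair_prob g p q x))"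
    using assms by (intro Pi_pmf_cong) (auto simp: upper_pairs_def pair_prob_def row_label_mat_eq_iff)
  moreover have "(\<lambda>e. Matrix.mat n n (\<lambda>(i, j). of_bool (e (min i j, max i j)))) = edge_mat n"
    by (simp add: edge_mat_def ordered_pair_def fun_eq_iff)
  ultimately show ?thesis by (simp add: sbm_pmf_def upper_pairs_def)
qed

text \<open>A union bound over vertices \<open>i\<close> and wrong labels \<open>l\<close>. In row
  \<open>i\<close> the weights are \<open>- \<tau>\<close> on the own community,
  \<open>\<tau>\<close> on \<open>l\<close> and 0 elsewhere; with the loop included, both
  communities contribute exactly \<open>m\<close> entries.\<close>

lemma prob_not_separated:
  assumes pq: "0 \<le> p" "p \<le> 1" "0 \<le> q" "q \<le> 1" and \<tau>: "\<tau> \<ge> 0"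
    and g: "\<And>i. i < n \<Longrightarrow> g i < K" "\<And>k. k < K \<Longrightarrow> card {i. i < n \<and> g i = k} = m"
  shows "measure_pmf.prob (Pi_pmf (upper_pairs n) False (\<lambda>x. bernoulli_pmf (pair_prob g p q x)))
    {e. \<not> separated n K \<delta> g (edge_mat n e)}
      \<le> real n * real K * exp (\<tau> * \<delta> + real m * (p * (exp (- \<tau>) - 1) + q * (exp \<tau> - 1)))"
proof -
  let ?M = "Pi_pmf (upper_pairs n) False (\<lambda>x. bernoulli_pmf (pair_prob g p q x))"
  define Q where "Q = {(i, l) \<in> {..<n} \<times> {..<K}. l \<noteq> g i}"
  have fin: "finite Q" by (auto simp: Q_def intro: finite_subset[of _ "{..<n} \<times> {..<K}"])
  define v where "v z j = \<tau> * (of_bool (g j = snd z) - of_bool (g j = g (fst z)))" for z :: "nat \<times> nat" and j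
  define bad where "bad z = {e. - \<tau> * \<delta> \<le> (\<Sum>j<n. v z j * of_bool (e (ordered_pair (fst z, j))))}" for z
  have bad: "measure_pmf.prob ?M (bad z)
      \<le> exp (\<tau> * \<delta> + real m * (p * (exp (- \<tau>) - 1) + q * (exp \<tau> - 1)))" if "z \<in> Q" for z
  proof -
    obtain i l where z: "z = (i, l)" by (cases z)
    have il: "i < n" "l < K" "l \<noteq> g i" using that by (auto simp: Q_def z)
    have "measure_pmf.prob ?M (bad z)
        \<le> exp ((\<Sum>j<n. pair_prob g p q (ordered_pair (i, j)) * (exp (v z j) - 1)) - - \<tau> * \<delta>)"
      unfolding bad_def z fst_conv
    proof (rule prob_Pi_bernoulli_sum_ge_reindexed)
      show "inj_on (\<lambda>j. ordered_pair (i, j)) {..<n}"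
        using inj_ordered_pair by (rule inj_on_subset) simp
    qed (use pq il in \<open>auto simp: pair_prob_def ordered_pair_in_upper_pairs\<close>)
    also have "(\<Sum>j<n. pair_prob g p q (ordered_pair (i, j)) * (exp (v z j) - 1))
        = (\<Sum>j<n. (if g j = g i then p * (exp (- \<tau>) - 1) else 0) + (if g j = l then q * (exp \<tau> - 1) else 0))"
      using il by (intro sum.cong) (auto simp: pair_prob_ordered_pair v_def z)
    also have "\<dots> = real m * (p * (exp (- \<tau>) - 1) + q * (exp \<tau> - 1))"
      using g(2)[OF g(1)[OF il(1)]] g(2)[OF il(2)]
      by (simp add: sum.distrib sum.If_cases Int_def distrib_left)
    finally show ?thesis by (simp add: add.commute)
  qed
  have "{e. \<not> separated n K \<delta> g (edge_mat n e)} \<subseteq> (\<Union>z\<in>Q. bad z)"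
  proof clarify
    fix e assume "\<not> separated n K \<delta> g (edge_mat n e)"
    then obtain i l where il: "i < n" "l < K" "l \<noteq> g i"
      "(\<Sum>j<n. edge_mat n e $$ (i, j) * of_bool (g j = g i))
        < (\<Sum>j<n. edge_mat n e $$ (i, j) * of_bool (g j = l)) + \<delta>"
      unfolding separated_def not_all not_imp not_le by blast
    then have "- \<delta> \<le> (\<Sum>j<n. edge_mat n e $$ (i, j) * of_bool (g j = l))
        - (\<Sum>j<n. edge_mat n e $$ (i, j) * of_bool (g j = g i))"
      by linarith
    also have "\<dots> = (\<Sum>j<n. edge_mat n e $$ (i, j) * (of_bool (g j = l) - of_bool (g j = g i)))"
      by (simp only: sum_subtractf right_diff_distrib)
    finally have "- \<delta> \<le> \<dots>" .
    from mult_left_mono[OF this \<tau>]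
    have "- \<tau> * \<delta> \<le> (\<Sum>j<n. \<tau> * (edge_mat n e $$ (i, j) * (of_bool (g j = l) - of_bool (g j = g i))))"
      by (simp only: sum_distrib_left mult_minus_right mult_minus_left)
    also have "\<dots> = (\<Sum>j<n. v (i, l) j * of_bool (e (ordered_pair (i, j))))"
      using il(1) by (intro sum.cong) (auto simp: v_def edge_mat_index)
    finally have "e \<in> bad (i, l)" by (simp add: bad_def)
    moreover have "(i, l) \<in> Q" using il by (simp add: Q_def)
    ultimately show "e \<in> (\<Union>z\<in>Q. bad z)" by blast
  qed
  then have "measure_pmf.prob ?M {e. \<not> separated n K \<delta> g (edge_mat n e)}
      \<le> measure_pmf.prob ?M (\<Union>z\<in>Q. bad z)"
    by (intro measure_pmf.finite_measure_mono) auto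
  also have "\<dots> \<le> (\<Sum>z\<in>Q. measure_pmf.prob ?M (bad z))"
    using fin by (intro measure_pmf.finite_measure_subadditive_finite) auto
  also have "\<dots> \<le> (\<Sum>z\<in>Q. exp (\<tau> * \<delta> + real m * (p * (exp (- \<tau>) - 1) + q * (exp \<tau> - 1))))"
    using bad by (intro sum_mono) auto
  also have "\<dots> \<le> real n * real K * exp (\<tau> * \<delta> + real m * (p * (exp (- \<tau>) - 1) + q * (exp \<tau> - 1)))"
  proof -
    have "card Q \<le> card ({..<n} \<times> {..<K})" by (intro card_mono) (auto simp: Q_def)
    then have "real (card Q) \<le> real n * real K" by (simp flip: of_nat_mult)
    then show ?thesis by (simp add: mult_right_mono)
  qed
  finally show ?thesis .
qed

text \<open>The tilt \<open>\<tau> = ln (\<alpha> / \<beta>) / 2\<close> minimises the exponent over all tilts, which is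
  what makes the threshold \<open>sqrt \<alpha> - sqrt \<beta> > sqrt K\<close> sufficient.\<close>

lemma optimal_tilt:
  fixes \<alpha> \<beta> :: real
  assumes "\<alpha> > 0" "\<beta> > 0"
  shows "\<alpha> * (exp (- (ln (\<alpha> / \<beta>) / 2)) - 1) + \<beta> * (exp (ln (\<alpha> / \<beta>) / 2) - 1) = - ((sqrt \<alpha> - sqrt \<beta>)\<^sup>2)"
proof -
  define a where "a = sqrt \<alpha>"
  define b where "b = sqrt \<beta>"
  have ab: "a > 0" "b > 0" "\<alpha> = a\<^sup>2" "\<beta> = b\<^sup>2" using assms by (auto simp: a_def b_def)
  have "ln (\<alpha> / \<beta>) / 2 = ln (a / b)"
    using ab(1,2) unfolding ab(3,4) by (simp add: ln_div ln_realpow)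
  \<comment> \<open>With these values both products equal \<open>a * b\<close>, and the square of
    \<open>a - b\<close> appears.\<close>
  then have "exp (ln (\<alpha> / \<beta>) / 2) = a / b" "exp (- (ln (\<alpha> / \<beta>) / 2)) = b / a"
    using ab(1,2) by (simp_all add: exp_minus)
  then show ?thesis using ab(1,2)
    unfolding a_def[symmetric] b_def[symmetric] by (simp add: ab(3,4) power2_eq_square field_simps)
qed

section \<open>Number of nonzero entries\<close>

lemma sum_pair_prob:
  assumes g: "\<And>i. i < n \<Longrightarrow> g i < K" "\<And>k. k < K \<Longrightarrow> card {i. i < n \<and> g i = k} = m" and n: "n = m * K"
  shows "(\<Sum>i<n. \<Sum>j<n. pair_prob g p q (ordered_pair (i, j))) = real n * (real m * (p + (real K - 1) * q))"
proof -
  have "(\<Sum>j<n. pair_prob g p q (ordered_pair (i, j))) = real m * (p + (real K - 1) * q)" if "i < n" for i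
  proof -
    have "(\<Sum>j<n. pair_prob g p q (ordered_pair (i, j))) = (\<Sum>j<n. q + (if g j = g i then p - q else 0))"
      by (intro sum.cong) (auto simp: pair_prob_ordered_pair)
    also have "\<dots> = real n * q + real m * (p - q)"
      using g(2)[OF g(1)[OF that]] by (simp add: sum.distrib sum.If_cases Int_def)
    finally show ?thesis by (simp add: n algebra_simps)
  qed
  then show ?thesis by simp
qed

lemma card_nonzeros_edge_mat:
  "real (card {(i, j). i < n \<and> j < n \<and> edge_mat n e $$ (i, j) \<noteq> 0})
    = (\<Sum>i<n. \<Sum>j<n. edge_mat n e $$ (i, j))"
proof -
  have "(\<Sum>i<n. \<Sum>j<n. edge_mat n e $$ (i, j)) = (\<Sum>i<n. \<Sum>j<n. of_bool (edge_mat n e $$ (i, j) \<noteq> 0))"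
    by (intro sum.cong) (auto simp: edge_mat_index)
  also have "\<dots> = (\<Sum>z\<in>{..<n} \<times> {..<n}. of_bool (edge_mat n e $$ z \<noteq> 0))"
    by (simp only: sum.cartesian_product case_prod_unfold prod.collapse)
  also have "\<dots> = real (card (({..<n} \<times> {..<n}) \<inter> {z. edge_mat n e $$ z \<noteq> 0}))"
    by (simp add: of_bool_def sum.If_cases)
  also have "({..<n} \<times> {..<n}) \<inter> {z. edge_mat n e $$ z \<noteq> 0}
      = {(i, j). i < n \<and> j < n \<and> edge_mat n e $$ (i, j) \<noteq> 0}" by auto
  finally show ?thesis by simp
qed

text \<open>With tilt 1 and \<open>exp 1 \<le> 3\<close> the exponent is at most
  \<open>2 * \<mu> - 6 * \<mu>\<close>, where 6 is half of 12 because of the symmetry.\<close>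

lemma prob_many_nonzeros:
  assumes P: "\<And>x. 0 \<le> P x \<and> P x \<le> 1"
    and \<mu>: "\<mu> = (\<Sum>i<n. \<Sum>j<n. P (ordered_pair (i, j)))"
  shows "measure_pmf.prob (Pi_pmf (upper_pairs n) False (\<lambda>x. bernoulli_pmf (P x)))
    {e. \<not> real (card {(i, j). i < n \<and> j < n \<and> edge_mat n e $$ (i, j) \<noteq> 0}) \<le> 12 * \<mu>} \<le> exp (- 4 * \<mu>)"
proof -
  let ?M = "Pi_pmf (upper_pairs n) False (\<lambda>x. bernoulli_pmf (P x))"
  have "\<mu> \<ge> 0" using P unfolding \<mu> by (intro sum_nonneg) auto
  then have "\<mu> * (exp 1 - 1) \<le> \<mu> * 2" using exp_le by (intro mult_left_mono) auto
  have "measure_pmf.prob ?M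
      {e. \<not> real (card {(i, j). i < n \<and> j < n \<and> edge_mat n e $$ (i, j) \<noteq> 0}) \<le> 12 * \<mu>}
      \<le> measure_pmf.prob ?M {e. 12 * \<mu> \<le> (\<Sum>i<n. \<Sum>j<n. edge_mat n e $$ (i, j))}"
    by (intro measure_pmf.finite_measure_mono) (auto simp: card_nonzeros_edge_mat)
  also have "\<dots> \<le> exp (\<mu> * (exp 1 - 1) - 1 * (12 * \<mu>) / 2)"
    unfolding \<mu> by (rule prob_edges_between_ge[OF P]) auto
  also have "\<dots> \<le> exp (- 4 * \<mu>)"
    using \<open>\<mu> * (exp 1 - 1) \<le> \<mu> * 2\<close> by simp
  finally show ?thesis .
qed

section \<open>Recovery and running time on a good graph\<close>

text \<open>Each round divides the errors by at least the square root of \<open>ln n\<close>, so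
  \<open>2 ln n / ln (ln n)\<close> rounds divide them by at least \<open>n\<close>. Fewer than one
  error then remains.\<close>

lemma ppm_recovers:
  assumes A: "A \<in> carrier_mat (m * K) (m * K)"
      "\<And>i j. i < m * K \<Longrightarrow> j < m * K \<Longrightarrow> A $$ (i, j) \<ge> 0"
    and g: "\<And>i. i < m * K \<Longrightarrow> g i < K" "\<And>k. k < K \<Longrightarrow> card {i. i < m * K \<and> g i = k} = m"
    and sep: "separated (m * K) K \<delta> g A" "\<delta> > 0"
    and sparse: "locally_sparse (m * K) \<epsilon> c \<delta> A" "0 \<le> c" "c \<le> 1 / sqrt (ln (real (m * K)))"
    and \<epsilon>: "0 < \<epsilon>" "\<epsilon> < 1"
    and l1: "ln (real (m * K)) > 1" and k: "2 * ln (real (m * K)) / ln (ln (real (m * K))) \<le> real k"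
    and H0: "H0 \<in> clustering_mats (m * K) K"
      "(MIN Q \<in> perm_mats K. frob_norm (H0 - label_mat (m * K) K g * Q)) \<le> sqrt \<epsilon> * sqrt (real (m * K))"
    and H: "(H, t) \<in> ppm cP m K A H0 k"
  shows "\<exists>Q\<in>perm_mats K. H = label_mat (m * K) K g * Q"
proof -
  define n where "n = m * K"
  define l where "l = ln (real n)"
  have l: "l > 1" using l1 by (simp add: l_def n_def)
  then have n0: "real n > 0" by (cases "n = 0") (auto simp: l_def)
  \<comment> \<open>The minimum over a finite nonempty set is attained; the relabelled truth found
    here is the reference for all later errors.\<close>
  have "(MIN Q \<in> perm_mats K. frob_norm (H0 - label_mat n K g * Q))
      \<in> (\<lambda>Q. frob_norm (H0 - label_mat n K g * Q)) ` perm_mats K"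
    using finite_perm_mats perm_mats_nonempty by (intro Min_in) auto
  then obtain Q where Q: "Q \<in> perm_mats K"
    "frob_norm (H0 - label_mat n K g * Q) \<le> sqrt \<epsilon> * sqrt (real n)"
    using H0(2) by (auto simp: n_def)
  then obtain \<sigma> where \<sigma>: "Q = Matrix.mat K K (\<lambda>(i, j). of_bool (\<sigma> i = j))" "\<sigma> permutes {..<K}"
    by (auto simp: perm_mats_def)
  define f where "f = \<sigma> \<circ> g"
  have GQ: "label_mat n K g * Q = label_mat n K f"
    using label_mat_mult_perm_mat[of n g K \<sigma>] g(1) by (simp add: \<sigma>(1) f_def n_def)
  have f: "f i < K" if "i < m * K" for i
    using permutes_in_image[OF \<sigma>(2), of "g i"] g(1)[OF that] by (simp add: f_def)
  have cardf: "card {i. i < m * K \<and> f i = k} = m" if "k < K" for k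
  proof -
    have "{i. i < m * K \<and> f i = k} = {i. i < m * K \<and> g i = inv_into UNIV \<sigma> k}"
      using permutes_inverses[OF \<sigma>(2)] by (auto simp: f_def)
    moreover have "inv_into UNIV \<sigma> k < K"
      using permutes_in_image[OF permutes_inv[OF \<sigma>(2)], of k] that by simp
    ultimately show ?thesis using g(2) by simp
  qed
  have feas: "label_mat (m * K) K f \<in> feasible_mats m K"
    using f cardf by (intro label_mat_feasible) auto
  have sepf: "separated (m * K) K \<delta> f A"
    unfolding f_def using sep(1) \<sigma>(2) g(1) by (rule separated_comp)
  from H0(1) obtain I where "clustering_by n K I H0" by (auto simp: clustering_mats_def n_def)
  then obtain h0 where h0: "\<And>i. i < n \<Longrightarrow> h0 i < K" "H0 = label_mat n K h0"
    by (rule clustering_by_label_mat) blast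
  have "(frob_norm (H0 - label_mat n K f))\<^sup>2 \<le> (sqrt \<epsilon> * sqrt (real n))\<^sup>2"
    using Q(2) by (intro power_mono frob_norm_nonneg) (simp add: GQ)
  then have mis: "2 * real (card (misfits n h0 f)) \<le> \<epsilon> * real n"
    using frob_norm_label_mat_diff[of n h0 K f] h0 f \<epsilon>(1)
    by (simp add: n_def power_mult_distrib)
  have "1 / sqrt l \<le> 1" using l by simp
  then have c1: "c \<le> 1" using sparse(3) by (simp add: l_def n_def)
  obtain h where h: "H = label_mat n K h" "real (card (misfits n h f)) \<le> c ^ k * (\<epsilon> * real n)"
    using ppm_misfits[OF A f feas sepf sep(2) sparse(1,2) c1, of h0 H t cP k] h0 mis H
    by (auto simp: n_def)
  have "c ^ k \<le> 1 / real n"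
  proof -
    have "ln l > 0" using l by simp
    then have kl: "l \<le> real k * (ln l / 2)"
      using k by (simp add: l_def n_def field_simps)
    have "c ^ k \<le> (1 / sqrt l) ^ k"
      using sparse(2,3) by (intro power_mono) (auto simp: l_def n_def)
    also have "1 / sqrt l = exp (- (ln l / 2))"
      using l by (simp add: exp_minus ln_sqrt[symmetric] field_simps)
    also have "\<dots> ^ k = exp (- (real k * (ln l / 2)))"
      by (subst exp_of_nat_mult[symmetric]) simp
    also have "\<dots> \<le> exp (- l)" using kl by simp
    also have "\<dots> = 1 / real n" using n0 by (simp add: l_def exp_minus field_simps)
    finally show ?thesis .
  qed
  then have "c ^ k * (\<epsilon> * real n) \<le> 1 / real n * (\<epsilon> * real n)"
    using \<epsilon>(1) by (intro mult_right_mono) auto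
  also have "\<dots> = \<epsilon>" using n0 by simp
  finally have "card (misfits n h f) = 0" using h(2) \<epsilon>(2) by linarith
  then have "misfits n h f = {}" by simp
  then have "label_mat n K h = label_mat n K f"
    by (intro label_mat_cong) (auto simp: misfits_def)
  then have "H = label_mat n K g * Q" using h(1) GQ by simp
  then show ?thesis using Q(1) unfolding n_def by blast
qed

text \<open>The second ceiling gives the lower bound. In the upper bound, 5 collects two roundings,
  the summand 2 of \<open>ppm_rounds\<close> and the additional projection.\<close>

lemma ppm_rounds_bounds:
  assumes "ln (real n) > 1"
    and "2 * ln (ln (real n)) + 2 * ln (real n) / ln (ln (real n)) + 5 \<le> 10 * (ln (real n) / ln (ln (real n)))"
  shows "2 * ln (real n) / ln (ln (real n)) \<le> real (ppm_rounds n)"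
    "real (ppm_rounds n + 1) \<le> 10 * (ln (real n) / ln (ln (real n)))"
proof -
  have "ln (ln (real n)) > 0" using assms(1) by simp
  then have pos: "0 \<le> 2 * ln (ln (real n))" "0 \<le> 2 * ln (real n) / ln (ln (real n))"
    using assms(1) by auto
  have nat_ceil: "x \<le> real (nat \<lceil>x\<rceil>) \<and> real (nat \<lceil>x\<rceil>) \<le> x + 1" if "0 \<le> x" for x :: real
    using that by linarith
  show "2 * ln (real n) / ln (ln (real n)) \<le> real (ppm_rounds n)"
    "real (ppm_rounds n + 1) \<le> 10 * (ln (real n) / ln (ln (real n)))"
    using nat_ceil[OF pos(1)] nat_ceil[OF pos(2)] assms(2)
    unfolding ppm_rounds_def of_nat_add of_nat_numeral of_nat_1 by linarith+
qed

text \<open>The factor \<open>K\<close> of a product cancels against the density, so a round costs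
  at most \<open>cP * K\<^sup>2 + 24 * W\<close> times \<open>n ln n\<close>. Adding cross terms
  turns this into \<open>(cP + 8) * (K\<^sup>2 + 3 * W)\<close>; the factor 10 bounds the
  rounds.\<close>

lemma ppm_time_bound:
  assumes A: "A \<in> carrier_mat (m * K) (m * K)" and K: "K \<ge> 1" and pos: "\<alpha> \<ge> 0" "\<beta> \<ge> 0" "cP > 0"
    and n: "n = m * K" and N: "real (card {(i, j). i < n \<and> j < n \<and> A $$ (i, j) \<noteq> 0})
      \<le> 12 * (real n * (ln (real n) * (\<alpha> + (real K - 1) * \<beta>) / real K))"
    and H: "(H, t) \<in> ppm cP m K A H0 k"
    and k: "real (k + 1) \<le> 10 * (ln (real n) / ln (ln (real n)))" and l1: "ln (real n) > 1"
  shows "real t \<le> 10 * (cP + 8) * (((real K)\<^sup>2 + 3 * \<alpha> + 3 * (real K - 1) * \<beta>)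
                              * (real n * (ln (real n))\<^sup>2 / ln (ln (real n))))"
proof -
  define l where "l = ln (real n)"
  have l: "l > 1" using l1 by (simp add: l_def)
  define W where "W = \<alpha> + (real K - 1) * \<beta>"
  have W: "W \<ge> 0" using K pos by (simp add: W_def)
  have "real t \<le> real (k + 1) * (cP * (real K)\<^sup>2 * real n * l)
      + real k * (2 * real K * (12 * (real n * (l * W / real K))))"
    using ppm_time[OF A N[unfolded n] H] unfolding n l_def W_def by blast
  also have "2 * real K * (12 * (real n * (l * W / real K))) = 24 * W * real n * l"
    using K by (simp add: field_simps)
  also have "real k * (24 * W * real n * l) \<le> real (k + 1) * (24 * W * real n * l)"
    using W l by (intro mult_right_mono) auto
  also have "real (k + 1) * (cP * (real K)\<^sup>2 * real n * l) + real (k + 1) * (24 * W * real n * l)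
      = real (k + 1) * ((cP * (real K)\<^sup>2 + 24 * W) * (real n * l))" by (simp add: algebra_simps)
  also have "\<dots> \<le> real (k + 1) * ((cP + 8) * ((real K)\<^sup>2 + 3 * W) * (real n * l))"
  proof -
    have "cP * (real K)\<^sup>2 + 24 * W \<le> cP * (real K)\<^sup>2 + 24 * W + (8 * (real K)\<^sup>2 + 3 * cP * W)"
      using pos W by simp
    also have "\<dots> = (cP + 8) * ((real K)\<^sup>2 + 3 * W)" by (simp add: algebra_simps)
    finally show ?thesis using l by (intro mult_left_mono mult_right_mono) auto
  qed
  also have "\<dots> \<le> 10 * (l / ln l) * ((cP + 8) * ((real K)\<^sup>2 + 3 * W) * (real n * l))"
    using k pos W l by (intro mult_right_mono) (auto simp: l_def)
  also have "\<dots> = 10 * (cP + 8) * (((real K)\<^sup>2 + 3 * W) * (real n * l\<^sup>2 / ln l))"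
    by (simp add: power2_eq_square)
  finally show ?thesis by (simp add: l_def W_def algebra_simps)
qed

section \<open>Choice of the constants and conclusion\<close>

lemma eventually_large_enough:
  fixes \<alpha> \<gamma> \<eta> c :: real
  assumes "\<gamma> > 0" "\<eta> > 0" "0 < c" "2 * c \<le> \<eta>" "2 * c \<le> 1"
  shows "\<forall>\<^sub>F n :: nat in sequentially. ln (real n) > 1 \<and> \<alpha> * ln (real n) / real n \<le> 1
    \<and> 32 / (\<gamma> * ln (real n)) \<le> 1 / sqrt (ln (real n))
    \<and> real K * real n powr (- \<eta>) + 2 / real n \<le> real n powr (- c)
    \<and> 2 * ln (ln (real n)) + 2 * ln (real n) / ln (ln (real n)) + 5 \<le> 10 * (ln (real n) / ln (ln (real n)))"
proof -
  have ev: "\<forall>\<^sub>F n :: nat in sequentially. ln (real n) > 1" by real_asymp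
  have "((\<lambda>n :: nat. \<alpha> * (ln (real n) / real n)) \<longlongrightarrow> \<alpha> * 0) sequentially"
    by (intro tendsto_mult tendsto_const) real_asymp
  then have "\<forall>\<^sub>F n :: nat in sequentially. \<alpha> * (ln (real n) / real n) < 1"
    by (rule order_tendstoD) simp
  moreover have "\<forall>\<^sub>F n :: nat in sequentially. sqrt (ln (real n)) \<ge> 32 / \<gamma>"
  proof -
    have "filterlim (\<lambda>n :: nat. sqrt (ln (real n))) at_top sequentially" by real_asymp
    then show ?thesis by (simp add: filterlim_at_top)
  qed
  moreover have "\<forall>\<^sub>F n :: nat in sequentially. real n powr c \<ge> real K + 2"
  proof -
    have "filterlim (\<lambda>n :: nat. real n powr c) at_top sequentially" using assms(3) by real_asymp
    then show ?thesis by (simp add: filterlim_at_top)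
  qed
  moreover have "\<forall>\<^sub>F n :: nat in sequentially.
      2 * ln (ln (real n)) + 2 * ln (real n) / ln (ln (real n)) + 5 \<le> 10 * (ln (real n) / ln (ln (real n)))"
    by real_asymp
  ultimately show ?thesis using ev
  proof eventually_elim
    case (elim n)
    define l where "l = ln (real n)"
    have l: "l > 1" using elim by (simp add: l_def)
    then have n: "real n \<ge> 1" by (cases "n = 0") (auto simp: l_def)
    have "32 / (\<gamma> * l) \<le> 1 / sqrt l"
    proof -
      have "32 \<le> \<gamma> * sqrt l" using elim(2) assms(1) by (simp add: l_def field_simps)
      then have "32 * sqrt l \<le> \<gamma> * sqrt l * sqrt l" using l by (intro mult_right_mono) auto
      also have "\<dots> = \<gamma> * l" using l by (simp add: mult.assoc)
      finally show ?thesis using l assms(1) by (simp add: field_simps)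
    qed
    moreover have "real K * real n powr (- \<eta>) + 2 / real n \<le> real n powr (- c)"
    proof -
      \<comment> \<open>Both failure rates are at most \<open>n powr (- 2 * c)\<close>; half of this
        exponent is given up to absorb the factor \<open>K + 2\<close>.\<close>
      have "real K * real n powr (- \<eta>) + 2 * real n powr (- 1)
          \<le> real K * real n powr (- 2 * c) + 2 * real n powr (- 2 * c)"
        using assms n by (intro add_mono mult_left_mono powr_mono) auto
      also have "\<dots> = (real K + 2) * real n powr (- 2 * c)" by (simp add: algebra_simps)
      also have "\<dots> \<le> real n powr c * real n powr (- 2 * c)"
        using elim(3) by (intro mult_right_mono) auto
      also have "\<dots> = real n powr (- c)" by (simp flip: powr_add)
      finally show ?thesis using n by (simp add: powr_minus_divide)
    qed
    ultimately show ?case using elim by (simp add: l_def)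
  qed
qed

text \<open>\<open>C\<close> is chosen before \<open>K\<close>, \<alpha> and \<beta> and depends
  only on the solver constant, so the dependence of the time bound on the model is explicit.\<close>

theorem corollary1:
  "\<exists>C :: real \<Rightarrow> real.
   \<forall>(K :: nat) (\<alpha> :: real) (\<beta> :: real).
     K \<ge> 2 \<and> \<alpha> > 0 \<and> \<beta> > 0 \<and> sqrt \<alpha> - sqrt \<beta> > sqrt (real K) \<longrightarrow>
     (\<exists>\<gamma> > 0. \<exists>c > 0. \<exists>n0 :: nat. \<forall>(m :: nat) (n :: nat) (Hs :: real mat).
        m > 0 \<and> n = m * K \<and> n \<ge> n0 \<and> Hs \<in> balanced_clustering_mats m K \<longrightarrow>
        measure_pmf.prob
          (sbm_pmf n (\<alpha> * ln (real n) / real n) (\<beta> * ln (real n) / real n) Hs)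
          {A. \<forall>H0 \<in> clustering_mats n K.
                (MIN Q \<in> perm_mats K. frob_norm (H0 - Hs * Q))
                  \<le> 1 / 4 * min (1 / sqrt (real K)) (\<gamma> * sqrt (real K) / (16 * (\<alpha> - \<beta>)))
                     * sqrt (real n) \<longrightarrow>
                (\<forall>cP > 0. \<forall>(H, t) \<in> ppm cP m K A H0 (ppm_rounds n).
                   (\<exists>Q \<in> perm_mats K. H = Hs * Q) \<and>
                   real t \<le> C cP * (((real K)\<^sup>2 + 3 * \<alpha> + 3 * (real K - 1) * \<beta>)
                              * (real n * (ln (real n))\<^sup>2 / ln (ln (real n)))))}
          \<ge> 1 - real n powr (- c))"
proof (rule exI[of _ "\<lambda>cP. 10 * (cP + 8)"], intro allI impI)
  fix K :: nat and \<alpha> \<beta> :: real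
  assume "K \<ge> 2 \<and> \<alpha> > 0 \<and> \<beta> > 0 \<and> sqrt \<alpha> - sqrt \<beta> > sqrt (real K)"
  then have K: "K \<ge> 2" and pos: "\<alpha> > 0" "\<beta> > 0" and gap: "sqrt \<alpha> - sqrt \<beta> > sqrt (real K)" by auto
  have sK: "sqrt (real K) > 0" using K by simp
  then have "sqrt \<beta> < sqrt \<alpha>" using gap by linarith
  then have \<beta>\<alpha>: "\<beta> < \<alpha>" by simp
  \<comment> \<open>The resulting bound \<open>K < \<alpha>\<close> makes the expected degree at
    least \<open>ln n\<close>, which the count of nonzero entries needs.\<close>
  have "sqrt (real K) < sqrt \<alpha>" using gap pos real_sqrt_gt_zero[of \<beta>] by linarith
  then have K\<alpha>: "real K < \<alpha>" by simp
  \<comment> \<open>The optimal exponent is \<open>1 + 2 * \<eta>\<close>: 1 offsets the union bound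
    over vertices, one \<eta> pays for the margin, and the other remains as the failure
    rate.\<close>
  define \<eta> where "\<eta> = ((sqrt \<alpha> - sqrt \<beta>)\<^sup>2 / real K - 1) / 2"
  have "(sqrt (real K))\<^sup>2 < (sqrt \<alpha> - sqrt \<beta>)\<^sup>2"
    using gap sK by (intro power_strict_mono) auto
  then have \<eta>: "\<eta> > 0" using K by (simp add: \<eta>_def)
  define \<tau> where "\<tau> = ln (\<alpha> / \<beta>) / 2"
  have \<tau>: "\<tau> > 0" using \<beta>\<alpha> pos by (simp add: \<tau>_def)
  define \<gamma>0 where "\<gamma>0 = \<eta> / \<tau>"
  have \<gamma>0: "\<gamma>0 > 0" "\<tau> * \<gamma>0 = \<eta>" using \<eta> \<tau> by (auto simp: \<gamma>0_def)
  \<comment> \<open>The first bound makes \<open>ln (n / card S)\<close> at least 1, as the counting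
    of sets \<open>S\<close> requires; the second makes it large enough for the Chernoff
    exponent.\<close>
  define \<epsilon> where "\<epsilon> = min (exp (- 1)) (exp (- (16 * (\<alpha> + 4) / \<gamma>0)))"
  have \<epsilon>: "0 < \<epsilon>" "\<epsilon> \<le> exp (- 1)" "\<epsilon> \<le> exp (- (16 * (\<alpha> + 4) / \<gamma>0))" by (auto simp: \<epsilon>_def)
  have "exp (- 1) < (1 :: real)" by simp
  with \<epsilon>(2) have \<epsilon>1: "\<epsilon> < 1" by linarith
  \<comment> \<open>\<open>\<gamma>\<close> enters the claim only through the radius \<open>\<theta>\<close>, so it is chosen to make
    \<open>\<theta> \<le> sqrt \<epsilon>\<close>; the separation margin of the degrees is \<open>\<gamma>0 ln n\<close>.\<close>
  define \<gamma> where "\<gamma> = 64 * (\<alpha> - \<beta>) * sqrt \<epsilon> / sqrt (real K)"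
  have \<gamma>: "\<gamma> > 0" using \<beta>\<alpha> \<epsilon> sK by (simp add: \<gamma>_def)
  have radius: "1 / 4 * min (1 / sqrt (real K)) (\<gamma> * sqrt (real K) / (16 * (\<alpha> - \<beta>))) \<le> sqrt \<epsilon>"
  proof -
    have "\<gamma> * sqrt (real K) / (16 * (\<alpha> - \<beta>)) = 4 * sqrt \<epsilon>"
      using \<beta>\<alpha> sK by (simp add: \<gamma>_def field_simps)
    then show ?thesis by simp
  qed
  define c where "c = min \<eta> 1 / 2"
  have c: "0 < c" "2 * c \<le> \<eta>" "2 * c \<le> 1" using \<eta> by (auto simp: c_def)
  obtain n0 where n0: "\<And>n :: nat. n \<ge> n0 \<Longrightarrow> ln (real n) > 1 \<and> \<alpha> * ln (real n) / real n \<le> 1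
    \<and> 32 / (\<gamma>0 * ln (real n)) \<le> 1 / sqrt (ln (real n))
    \<and> real K * real n powr (- \<eta>) + 2 / real n \<le> real n powr (- c)
    \<and> 2 * ln (ln (real n)) + 2 * ln (real n) / ln (ln (real n)) + 5 \<le> 10 * (ln (real n) / ln (ln (real n)))"
    using eventually_large_enough[OF \<gamma>0(1) \<eta> c, of \<alpha> K] unfolding eventually_sequentially by blast
  show "\<exists>\<gamma> > 0. \<exists>c > 0. \<exists>n0 :: nat. \<forall>(m :: nat) (n :: nat) (Hs :: real mat).
        m > 0 \<and> n = m * K \<and> n \<ge> n0 \<and> Hs \<in> balanced_clustering_mats m K \<longrightarrow>
        measure_pmf.prob
          (sbm_pmf n (\<alpha> * ln (real n) / real n) (\<beta> * ln (real n) / real n) Hs)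
          {A. \<forall>H0 \<in> clustering_mats n K.
                (MIN Q \<in> perm_mats K. frob_norm (H0 - Hs * Q))
                  \<le> 1 / 4 * min (1 / sqrt (real K)) (\<gamma> * sqrt (real K) / (16 * (\<alpha> - \<beta>)))
                     * sqrt (real n) \<longrightarrow>
                (\<forall>cP > 0. \<forall>(H, t) \<in> ppm cP m K A H0 (ppm_rounds n).
                   (\<exists>Q \<in> perm_mats K. H = Hs * Q) \<and>
                   real t \<le> 10 * (cP + 8) * (((real K)\<^sup>2 + 3 * \<alpha> + 3 * (real K - 1) * \<beta>)
                              * (real n * (ln (real n))\<^sup>2 / ln (ln (real n)))))}
          \<ge> 1 - real n powr (- c)"
  proof (rule exI[of _ \<gamma>], rule conjI[OF \<gamma>], rule exI[of _ c], rule conjI[OF c(1)], rule exI[of _ n0],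
      intro allI impI, elim conjE)
    fix m n :: nat and Hs :: "real mat"
    assume m: "m > 0" and n: "n = m * K" "n \<ge> n0" and Hs: "Hs \<in> balanced_clustering_mats m K"
    define l where "l = ln (real n)"
    note large = n0[OF n(2)]
    have l: "l > 1" using large by (simp add: l_def)
    have n2: "n \<ge> 2" using m K n(1) by (simp add: mult_le_mono[of 1 m 2 K, simplified])
    have nm: "real n = real m * real K" using n(1) by simp
    have exp_l: "exp l = real n" using n2 by (simp add: l_def)
    define p where "p = \<alpha> * ln (real n) / real n"
    define q where "q = \<beta> * ln (real n) / real n"
    have q_le: "q \<le> p"
      using \<beta>\<alpha> l unfolding p_def q_def by (intro divide_right_mono mult_right_mono) (auto simp: l_def)
    have pq: "0 \<le> p" "p \<le> 1" "0 \<le> q" "q \<le> 1"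
      using pos l large q_le by (auto simp: p_def q_def l_def)
    obtain I where I: "clustering_by (m * K) K I Hs" "\<forall>k<K. card (I k) = m"
      using Hs by (auto simp: balanced_clustering_mats_def)
    obtain g where g: "\<And>i. i < n \<Longrightarrow> g i < K" "Hs = label_mat n K g"
      "\<And>k. k < K \<Longrightarrow> I k = {i. i < n \<and> g i = k}"
      using clustering_by_label_mat[OF I(1)] unfolding n(1)[symmetric] by blast
    then have card_g: "card {i. i < n \<and> g i = k} = m" if "k < K" for k
      using I(2) that by simp
    \<comment> \<open>Since \<open>n = m * K\<close>, a community of size \<open>m\<close> has
      \<open>m * p = \<alpha> * l / K\<close>, and likewise for \<open>q\<close>.\<close>
    have m_pq: "real m * (p * x + q * y) = l / real K * (\<alpha> * x + \<beta> * y)" for x y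
    proof -
      have "real m * (p * x + q * y) = real m * (l / real n) * (\<alpha> * x + \<beta> * y)"
        by (simp add: p_def q_def l_def algebra_simps add_divide_distrib)
      also have "real m * (l / real n) = l / real K" using m K by (simp add: nm)
      finally show ?thesis .
    qed
    define P where "P = pair_prob g p q"
    have P: "0 \<le> P x \<and> P x \<le> p" "0 \<le> P x \<and> P x \<le> 1" for x
      using pq q_le by (auto simp: P_def pair_prob_def)
    define M where "M = Pi_pmf (upper_pairs n) False (\<lambda>x. bernoulli_pmf (P x))"
    define W where "W = l * (\<alpha> + (real K - 1) * \<beta>) / real K"
    define B1 where "B1 = {e. \<not> separated n K (\<gamma>0 * l) g (edge_mat n e)}"
    define B2 where "B2 = {e. \<not> locally_sparse n \<epsilon> (32 / (\<gamma>0 * l)) (\<gamma>0 * l) (edge_mat n e)}"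
    define B3 where "B3 = {e. \<not> real (card {(i, j). i < n \<and> j < n \<and> edge_mat n e $$ (i, j) \<noteq> 0}) \<le> 12 * (real n * W)}"
    have B1: "measure_pmf.prob M B1 \<le> real K * real n powr (- \<eta>)"
    proof -
      have "measure_pmf.prob M B1
          \<le> real n * real K * exp (\<tau> * (\<gamma>0 * l) + real m * (p * (exp (- \<tau>) - 1) + q * (exp \<tau> - 1)))"
        unfolding M_def B1_def P_def using pq \<tau> g(1) card_g by (intro prob_not_separated) auto
      also have "real m * (p * (exp (- \<tau>) - 1) + q * (exp \<tau> - 1))
          = l / real K * (\<alpha> * (exp (- \<tau>) - 1) + \<beta> * (exp \<tau> - 1))"
        by (rule m_pq)
      also have "\<dots> = - l * (1 + 2 * \<eta>)"
        using K unfolding \<tau>_def optimal_tilt[OF pos] by (simp add: \<eta>_def field_simps)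
      also have "\<tau> * (\<gamma>0 * l) = l * \<eta>" using \<gamma>0(2) by (simp add: mult.assoc[symmetric] mult.commute)
      \<comment> \<open>The factor \<open>exp (- l)\<close> is \<open>1 / n\<close> and cancels the
        number of vertices.\<close>
      also have "exp (l * \<eta> + - l * (1 + 2 * \<eta>)) = exp (- l) * exp (- \<eta> * l)"
        by (simp add: exp_add[symmetric] algebra_simps)
      also have "exp (- l) = 1 / real n" by (simp add: exp_minus exp_l field_simps)
      also have "exp (- \<eta> * l) = real n powr (- \<eta>)" using n2 by (simp add: powr_def l_def)
      finally show ?thesis using n2 by simp
    qed
    have B2: "measure_pmf.prob M B2 \<le> 1 / real n"
      unfolding M_def B2_def l_def
      using P(1) pq(2) pos \<gamma>0(1) n2 \<epsilon> unfolding p_def by (intro prob_not_locally_sparse) auto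
    have B3: "measure_pmf.prob M B3 \<le> 1 / real n"
    proof -
      have \<mu>: "real n * W = (\<Sum>i<n. \<Sum>j<n. P (ordered_pair (i, j)))"
      proof -
        have "(\<Sum>i<n. \<Sum>j<n. P (ordered_pair (i, j))) = real n * (real m * (p + (real K - 1) * q))"
          unfolding P_def using g(1) card_g n(1) by (intro sum_pair_prob) auto
        also have "real m * (p + (real K - 1) * q) = W"
            using m_pq[of 1 "real K - 1"] by (simp add: W_def mult.commute)
        finally show ?thesis by simp
      qed
      have "measure_pmf.prob M B3 \<le> exp (- 4 * (real n * W))"
        unfolding M_def B3_def by (rule prob_many_nonzeros[OF P(2) \<mu>])
      also have "\<dots> \<le> exp (- l)"
      proof -
        have "real K \<le> \<alpha> + (real K - 1) * \<beta>" using K\<alpha> K pos by (simp add: add_increasing2)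
        then have "l * real K \<le> l * (\<alpha> + (real K - 1) * \<beta>)" using l by (intro mult_left_mono) auto
        then have W: "l \<le> W" using K by (simp add: W_def field_simps)
        then have "1 * W \<le> real n * W" using n2 l by (intro mult_right_mono) auto
        with W l have "- 4 * (real n * W) \<le> - l" by linarith
        then show ?thesis by simp
      qed
      also have "\<dots> = 1 / real n" by (simp add: exp_minus exp_l field_simps)
      finally show ?thesis .
    qed
    let ?good = "{A. \<forall>H0 \<in> clustering_mats n K.
                (MIN Q \<in> perm_mats K. frob_norm (H0 - Hs * Q))
                  \<le> 1 / 4 * min (1 / sqrt (real K)) (\<gamma> * sqrt (real K) / (16 * (\<alpha> - \<beta>)))
                     * sqrt (real n) \<longrightarrow>
                (\<forall>cP > 0. \<forall>(H, t) \<in> ppm cP m K A H0 (ppm_rounds n).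
                   (\<exists>Q \<in> perm_mats K. H = Hs * Q) \<and>
                   real t \<le> 10 * (cP + 8) * (((real K)\<^sup>2 + 3 * \<alpha> + 3 * (real K - 1) * \<beta>)
                              * (real n * (ln (real n))\<^sup>2 / ln (ln (real n)))))}"
    \<comment> \<open>None of the three bad events mentions \<open>H0\<close> or \<open>cP\<close>,
      so one good graph serves all initial points, minimizers and solver times.\<close>
    have good: "UNIV - (B1 \<union> B2 \<union> B3) \<subseteq> edge_mat n -` ?good"
    proof
      fix e assume e: "e \<in> UNIV - (B1 \<union> B2 \<union> B3)"
      have *: "(\<exists>Q\<in>perm_mats K. H = Hs * Q) \<and>
          real t \<le> 10 * (cP + 8) * (((real K)\<^sup>2 + 3 * \<alpha> + 3 * (real K - 1) * \<beta>)
                              * (real n * (ln (real n))\<^sup>2 / ln (ln (real n))))"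
        if H0: "H0 \<in> clustering_mats n K"
          "(MIN Q \<in> perm_mats K. frob_norm (H0 - Hs * Q))
                  \<le> 1 / 4 * min (1 / sqrt (real K)) (\<gamma> * sqrt (real K) / (16 * (\<alpha> - \<beta>)))
                     * sqrt (real n)" and cP: "cP > (0 :: real)"
          and H: "(H, t) \<in> ppm cP m K (edge_mat n e) H0 (ppm_rounds n)"
        for H0 cP H t
      proof -
        let ?A = "edge_mat n e"
        have sep: "separated n K (\<gamma>0 * l) g ?A" and sparse: "locally_sparse n \<epsilon> (32 / (\<gamma>0 * l)) (\<gamma>0 * l) ?A"
          and N: "real (card {(i, j). i < n \<and> j < n \<and> ?A $$ (i, j) \<noteq> 0}) \<le> 12 * (real n * W)"
          using e by (auto simp: B1_def B2_def B3_def)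
        have rounds: "2 * ln (real n) / ln (ln (real n)) \<le> real (ppm_rounds n)"
          "real (ppm_rounds n + 1) \<le> 10 * (ln (real n) / ln (ln (real n)))"
          using large ppm_rounds_bounds[of n] by blast+
        have "(MIN Q \<in> perm_mats K. frob_norm (H0 - label_mat n K g * Q)) \<le> sqrt \<epsilon> * sqrt (real n)"
          by (rule order_trans[OF H0(2)[unfolded g(2)] mult_right_mono[OF radius]]) simp
        then have "\<exists>Q\<in>perm_mats K. H = label_mat n K g * Q"
          using ppm_recovers[of ?A m K g "\<gamma>0 * l" \<epsilon> "32 / (\<gamma>0 * l)" "ppm_rounds n" H0 H t cP]
            g(1) card_g sep sparse \<gamma>0(1) l large \<epsilon>(1) \<epsilon>1 rounds(1) H0(1) H
          unfolding n(1)[symmetric] by (simp add: edge_mat_index flip: l_def)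
        moreover have "real t \<le> 10 * (cP + 8) * (((real K)\<^sup>2 + 3 * \<alpha> + 3 * (real K - 1) * \<beta>)
                                * (real n * (ln (real n))\<^sup>2 / ln (ln (real n))))"
          using N K pos cP l n(1) H rounds(2)
          by (intro ppm_time_bound[of ?A m K \<alpha> \<beta> cP n H t H0 "ppm_rounds n"]) (auto simp: W_def l_def)
        ultimately show ?thesis by (simp add: g(2))
      qed
      show "e \<in> edge_mat n -` ?good"
        by (rule vimageI2, rule CollectI, clarify, rule *; assumption)
    qed
    have "measure_pmf.prob M (B1 \<union> B2 \<union> B3) \<le> real K * real n powr (- \<eta>) + 1 / real n + 1 / real n"
      using B1 B2 B3 measure_Un_le[of B1 "measure_pmf M" B2]
        measure_Un_le[of "B1 \<union> B2" "measure_pmf M" B3] by simp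
    also have "\<dots> \<le> real n powr (- c)" using large by simp
    finally have "1 - real n powr (- c) \<le> 1 - measure_pmf.prob M (B1 \<union> B2 \<union> B3)" by simp
    also have "\<dots> = measure_pmf.prob M (UNIV - (B1 \<union> B2 \<union> B3))"
      using measure_pmf.prob_compl[of "B1 \<union> B2 \<union> B3" M] by simp
    also have "\<dots> \<le> measure_pmf.prob M (edge_mat n -` ?good)"
      using good by (intro measure_pmf.finite_measure_mono) auto
    also have "\<dots> = measure_pmf.prob (map_pmf (edge_mat n) M) ?good" by simp
    also have "map_pmf (edge_mat n) M = sbm_pmf n p q Hs"
      unfolding g(2) M_def P_def using g(1) by (intro sbm_pmf_label_mat[symmetric]) auto
    finally show "measure_pmf.prob
          (sbm_pmf n (\<alpha> * ln (real n) / real n) (\<beta> * ln (real n) / real n) Hs) ?good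
          \<ge> 1 - real n powr (- c)"
      unfolding p_def q_def .
  qed
qed

end
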